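(* Let $R$ be a commutative Noetherian integral domain without $\mathbb{Z}$-torsion and let $\delta$ be a derivation of $R$ such that $R$ is $\delta$-simple. If the Krull dimension of $R$ is at most $1$, then $S=R[\theta;\delta]$ satisfies $(\diamond)$.
   Context: A derivation of a commutative ring $R$ is an additive map $\delta: R\to R$ with $\delta(ab)=\delta(a)b+a\delta(b)$. A $\delta$-ideal is an ideal $I$ of $R$ with $\delta(I)\subseteq I$; $R$ is $\delta$-simple if $0$ and $R$ are its only $\delta$-ideals. "Without $\mathbb{Z}$-torsion" means the additive group of $R$ is torsion-free. The differential operator ring $R[\theta;\delta]$ is the free left $R$-module with basis $1,\theta,\theta^2,\ldots$ with multiplication extending that of $R$ and determined by $\theta a = a\theta+\delta(a)$ for $a\in R$. A Noetherian ring $S$ satisfies property $(\diamond)$ if every cyclic essential extension of a simple $S$-module is Artinian; modules are left modules. *)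

theory Defs
  imports "HOL-Algebra.UnivPoly" "HOL-Algebra.Ring_Divisibility" "HOL-Library.Extended_Nat"
begin

locale derivation = R?: cring R for R (structure) +
  fixes \<delta> :: "'a \<Rightarrow> 'a"
  assumes d_closed [simp, intro]: "a \<in> carrier R \<Longrightarrow> \<delta> a \<in> carrier R"
    and d_add: "\<lbrakk>a \<in> carrier R; b \<in> carrier R\<rbrakk> \<Longrightarrow> \<delta> (a \<oplus> b) = \<delta> a \<oplus> \<delta> b"
    and d_mult: "\<lbrakk>a \<in> carrier R; b \<in> carrier R\<rbrakk> \<Longrightarrow> \<delta> (a \<otimes> b) = \<delta> a \<otimes> b \<oplus> a \<otimes> \<delta> b"

definition delta_ideal :: "('a, 'm) ring_scheme \<Rightarrow> ('a \<Rightarrow> 'a) \<Rightarrow> 'a set \<Rightarrow> bool" where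
  "delta_ideal R \<delta> I \<longleftrightarrow> ideal I R \<and> \<delta> ` I \<subseteq> I"

definition delta_simple :: "('a, 'm) ring_scheme \<Rightarrow> ('a \<Rightarrow> 'a) \<Rightarrow> bool" where
  "delta_simple R \<delta> \<longleftrightarrow> (\<forall>I. delta_ideal R \<delta> I \<longrightarrow> I = {\<zero>\<^bsub>R\<^esub>} \<or> I = carrier R)"

definition torsion_free :: "('a, 'm) ring_scheme \<Rightarrow> bool" where
  "torsion_free R \<longleftrightarrow>
    (\<forall>n::nat. \<forall>x \<in> carrier R. n > 0 \<longrightarrow> [n] \<cdot>\<^bsub>R\<^esub> x = \<zero>\<^bsub>R\<^esub> \<longrightarrow> x = \<zero>\<^bsub>R\<^esub>)"

definition krull_dim :: "('a, 'm) ring_scheme \<Rightarrow> enat" where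
  "krull_dim R = Sup {enat n | n. \<exists>P :: nat \<Rightarrow> 'a set.
     (\<forall>i\<le>n. primeideal (P i) R) \<and> (\<forall>i<n. P i \<subset> P (Suc i))}"

text \<open>
  The underlying left module of \<open>R[\<theta>;\<delta>]\<close> is that of \<^term>\<open>UP R\<close>: the finitely supported
  sequence \<open>f\<close> stands for \<open>\<Sum>i. f i \<theta>\<^sup>i\<close>, coefficients on the left.
  Since \<open>\<theta> a \<theta>\<^sup>n = a \<theta>\<^sup>n\<^sup>+\<^sup>1 + \<delta>(a) \<theta>\<^sup>n\<close>, left multiplication by \<open>\<theta>\<close> is the following operator,
  and \<open>(\<Sum>i. f i \<theta>\<^sup>i) g = \<Sum>i. f i (\<theta>\<^sup>i g)\<close>.
\<close>

definition theta_act :: "('a, 'm) ring_scheme \<Rightarrow> ('a \<Rightarrow> 'a) \<Rightarrow> (nat \<Rightarrow> 'a) \<Rightarrow> nat \<Rightarrow> 'a" where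
  "theta_act R \<delta> g = (\<lambda>n. (case n of 0 \<Rightarrow> \<zero>\<^bsub>R\<^esub> | Suc m \<Rightarrow> g m) \<oplus>\<^bsub>R\<^esub> \<delta> (g n))"

definition diff_op_ring :: "('a, 'm) ring_scheme \<Rightarrow> ('a \<Rightarrow> 'a) \<Rightarrow> (nat \<Rightarrow> 'a) ring" where
  "diff_op_ring R \<delta> = \<lparr>
     carrier = carrier (UP R),
     monoid.mult = (\<lambda>f g. \<Oplus>\<^bsub>UP R\<^esub>i \<in> {..deg R f}. f i \<odot>\<^bsub>UP R\<^esub> (theta_act R \<delta> ^^ i) g),
     one = \<one>\<^bsub>UP R\<^esub>,
     ring.zero = \<zero>\<^bsub>UP R\<^esub>,
     add = (\<oplus>\<^bsub>UP R\<^esub>)\<rparr>"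

text \<open>
  The library locale \<^locale>\<open>module\<close> requires a commutative ring of scalars; this is the same
  set of axioms over an arbitrary ring. The library locale \<^locale>\<open>submodule\<close> has no such
  restriction and is used as it is.
\<close>

locale left_module = S?: ring S + M?: abelian_group M
  for S :: "('s, 'x) ring_scheme" (structure) and M :: "('s, 'm, 'y) module_scheme" (structure) +
  assumes smult_closed:
      "\<lbrakk>a \<in> carrier S; x \<in> carrier M\<rbrakk> \<Longrightarrow> a \<odot>\<^bsub>M\<^esub> x \<in> carrier M"
    and smult_l_distr:
      "\<lbrakk>a \<in> carrier S; b \<in> carrier S; x \<in> carrier M\<rbrakk> \<Longrightarrow>
       (a \<oplus> b) \<odot>\<^bsub>M\<^esub> x = a \<odot>\<^bsub>M\<^esub> x \<oplus>\<^bsub>M\<^esub> b \<odot>\<^bsub>M\<^esub> x"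
    and smult_r_distr:
      "\<lbrakk>a \<in> carrier S; x \<in> carrier M; y \<in> carrier M\<rbrakk> \<Longrightarrow>
       a \<odot>\<^bsub>M\<^esub> (x \<oplus>\<^bsub>M\<^esub> y) = a \<odot>\<^bsub>M\<^esub> x \<oplus>\<^bsub>M\<^esub> a \<odot>\<^bsub>M\<^esub> y"
    and smult_assoc:
      "\<lbrakk>a \<in> carrier S; b \<in> carrier S; x \<in> carrier M\<rbrakk> \<Longrightarrow>
       (a \<otimes> b) \<odot>\<^bsub>M\<^esub> x = a \<odot>\<^bsub>M\<^esub> (b \<odot>\<^bsub>M\<^esub> x)"
    and smult_one: "x \<in> carrier M \<Longrightarrow> \<one> \<odot>\<^bsub>M\<^esub> x = x"

definition simple_module :: "('s, 'x) ring_scheme \<Rightarrow> ('s, 'm) module \<Rightarrow> bool" where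
  "simple_module S M \<longleftrightarrow> left_module S M \<and> carrier M \<noteq> {\<zero>\<^bsub>M\<^esub>} \<and>
     (\<forall>N. submodule N S M \<longrightarrow> N = {\<zero>\<^bsub>M\<^esub>} \<or> N = carrier M)"

definition cyclic_module :: "('s, 'x) ring_scheme \<Rightarrow> ('s, 'm) module \<Rightarrow> bool" where
  "cyclic_module S M \<longleftrightarrow> left_module S M \<and>
     (\<exists>x \<in> carrier M. carrier M = (\<lambda>a. a \<odot>\<^bsub>M\<^esub> x) ` carrier S)"

definition artinian_module :: "('s, 'x) ring_scheme \<Rightarrow> ('s, 'm) module \<Rightarrow> bool" where
  "artinian_module S M \<longleftrightarrow> left_module S M \<and>
     (\<forall>N :: nat \<Rightarrow> 'm set. (\<forall>i. submodule (N i) S M) \<and> (\<forall>i. N (Suc i) \<subseteq> N i) \<longrightarrow>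
        (\<exists>k. \<forall>i\<ge>k. N i = N k))"

text \<open>\<open>M\<close> is an essential extension of its submodule \<open>E\<close>.\<close>

definition essential_extension ::
    "('s, 'x) ring_scheme \<Rightarrow> 'm set \<Rightarrow> ('s, 'm) module \<Rightarrow> bool" where
  "essential_extension S E M \<longleftrightarrow> left_module S M \<and> submodule E S M \<and>
     (\<forall>N. submodule N S M \<and> N \<noteq> {\<zero>\<^bsub>M\<^esub>} \<longrightarrow> E \<inter> N \<noteq> {\<zero>\<^bsub>M\<^esub>})"

definition left_ideal :: "('s, 'x) ring_scheme \<Rightarrow> 's set \<Rightarrow> bool" where
  "left_ideal S I \<longleftrightarrow> additive_subgroup I S \<and>
     (\<forall>a \<in> carrier S. \<forall>x \<in> I. a \<otimes>\<^bsub>S\<^esub> x \<in> I)"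

definition right_ideal :: "('s, 'x) ring_scheme \<Rightarrow> 's set \<Rightarrow> bool" where
  "right_ideal S I \<longleftrightarrow> additive_subgroup I S \<and>
     (\<forall>a \<in> carrier S. \<forall>x \<in> I. x \<otimes>\<^bsub>S\<^esub> a \<in> I)"

text \<open>
  Two-sided Noetherianity. The library locale \<^locale>\<open>noetherian_ring\<close> speaks of two-sided ideals
  and is the right notion only over commutative rings.
\<close>

definition nc_noetherian :: "('s, 'x) ring_scheme \<Rightarrow> bool" where
  "nc_noetherian S \<longleftrightarrow> ring S \<and>
     (\<forall>I :: nat \<Rightarrow> 's set. (\<forall>i. left_ideal S (I i)) \<and> (\<forall>i. I i \<subseteq> I (Suc i)) \<longrightarrow>
        (\<exists>k. \<forall>i\<ge>k. I i = I k)) \<and>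
     (\<forall>I :: nat \<Rightarrow> 's set. (\<forall>i. right_ideal S (I i)) \<and> (\<forall>i. I i \<subseteq> I (Suc i)) \<longrightarrow>
        (\<exists>k. \<forall>i\<ge>k. I i = I k))"

text \<open>
  The property ranges over all modules with elements in \<open>'m\<close>; the type argument is needed
  because a definition cannot quantify over types. A theorem that leaves \<open>'m\<close> free speaks about
  all modules. The simple module is taken to be a submodule \<open>E\<close> of its extension.
\<close>

definition diamond :: "('s, 'x) ring_scheme \<Rightarrow> 'm itself \<Rightarrow> bool" where
  "diamond S (_ :: 'm itself) \<longleftrightarrow> nc_noetherian S \<and>
     (\<forall>(M :: ('s, 'm) module) E.
        simple_module S (M\<lparr>carrier := E\<rparr>) \<and> essential_extension S E M \<and> cyclic_module S M \<longrightarrow>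
        artinian_module S M)"

text \<open>
  Sanity check of the encoding: \<open>R[\<theta>;\<delta>]\<close> is a ring containing \<open>R\<close>, \<open>\<theta> a = a \<theta> + \<delta>(a)\<close> holds, and
  \<open>\<theta>\<^sup>n\<close> is the \<open>n\<close>-th basis element of the free module \<^term>\<open>UP R\<close>, on which \<open>R\<close> acts as usual.
\<close>

context derivation
begin

abbreviation (input) "P \<equiv> UP R"
abbreviation (input) "L \<equiv> theta_act R \<delta>"
abbreviation (input) "D \<equiv> diff_op_ring R \<delta>"

interpretation U: UP_cring R "UP R"
  by unfold_locales simp

lemma d_zero [simp]: "\<delta> \<zero> = \<zero>"
proof -
  have "\<delta> \<zero> \<oplus> \<delta> \<zero> = \<delta> \<zero> \<oplus> \<zero>" using d_add[of \<zero> \<zero>] by simp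
  then show ?thesis using R.add.l_cancel by blast
qed

lemma d_one [simp]: "\<delta> \<one> = \<zero>"
proof -
  have "\<delta> \<one> \<oplus> \<delta> \<one> = \<delta> \<one> \<oplus> \<zero>" using d_mult[of \<one> \<one>] by simp
  then show ?thesis using R.add.l_cancel by blast
qed

lemma UP_nth: "f \<in> carrier P \<Longrightarrow> f n = coeff P f n"
  by (simp add: UP_def)

lemma UP_nth_closed: "f \<in> carrier P \<Longrightarrow> f n \<in> carrier R"
  by (simp add: UP_nth)

lemma L_closed [simp]:
  assumes "g \<in> carrier P" shows "L g \<in> carrier P"
proof -
  have "L g n \<in> carrier R" for n
    using assms UP_nth_closed by (auto simp: theta_act_def split: nat.split)
  moreover have "bound \<zero> (Suc (deg R g)) (L g)"
  proof
    fix m assume m: "Suc (deg R g) < m"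
    then obtain k where k: "m = Suc k" by (cases m) auto
    with m have "g k = \<zero>" "g m = \<zero>"
      using assms by (auto simp: UP_nth U.deg_aboveD)
    with k show "L g m = \<zero>" by (simp add: theta_act_def)
  qed
  ultimately show ?thesis by (auto simp: UP_def)
qed

lemma coeff_L:
  "g \<in> carrier P \<Longrightarrow>
    coeff P (L g) n = (case n of 0 \<Rightarrow> \<zero> | Suc m \<Rightarrow> coeff P g m) \<oplus> \<delta> (coeff P g n)"
  by (simp add: UP_nth[symmetric]) (simp add: theta_act_def UP_nth split: nat.split)

lemma L_add: "\<lbrakk>f \<in> carrier P; g \<in> carrier P\<rbrakk> \<Longrightarrow> L (f \<oplus>\<^bsub>P\<^esub> g) = L f \<oplus>\<^bsub>P\<^esub> L g"
  by (rule U.up_eqI) (auto simp: coeff_L d_add R.a_ac split: nat.split)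

lemma L_smult:
  "\<lbrakk>a \<in> carrier R; g \<in> carrier P\<rbrakk> \<Longrightarrow> L (a \<odot>\<^bsub>P\<^esub> g) = a \<odot>\<^bsub>P\<^esub> L g \<oplus>\<^bsub>P\<^esub> \<delta> a \<odot>\<^bsub>P\<^esub> g"
  by (rule U.up_eqI) (auto simp: coeff_L d_mult R.r_distr R.a_ac split: nat.split)

lemma Ln_closed [simp]: "g \<in> carrier P \<Longrightarrow> (L ^^ i) g \<in> carrier P"
  by (induction i) auto

lemma Ln_add:
  "\<lbrakk>f \<in> carrier P; g \<in> carrier P\<rbrakk> \<Longrightarrow> (L ^^ i) (f \<oplus>\<^bsub>P\<^esub> g) = (L ^^ i) f \<oplus>\<^bsub>P\<^esub> (L ^^ i) g"
  by (induction i) (auto simp: L_add)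

lemma L_zero: "L \<zero>\<^bsub>P\<^esub> = \<zero>\<^bsub>P\<^esub>"
  by (rule U.up_eqI) (auto simp: coeff_L split: nat.split)

lemma L_monom: "a \<in> carrier R \<Longrightarrow> L (monom P a n) = monom P a (Suc n) \<oplus>\<^bsub>P\<^esub> monom P (\<delta> a) n"
  by (rule U.up_eqI) (auto simp: coeff_L split: nat.split)

lemma Ln_one: "(L ^^ i) \<one>\<^bsub>P\<^esub> = monom P \<one> i"
  by (induction i) (auto simp: L_monom)

lemma D_simps [simp]:
  "carrier D = carrier P" "ring.zero D = ring.zero P" "one D = one P" "add D = add P"
  by (simp_all add: diff_op_ring_def)

lemma D_mult_coeff:
  "f \<in> carrier P \<Longrightarrow> f \<otimes>\<^bsub>D\<^esub> g = (\<Oplus>\<^bsub>P\<^esub>i \<in> {..deg R f}. coeff P f i \<odot>\<^bsub>P\<^esub> (L ^^ i) g)"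
  by (simp add: diff_op_ring_def UP_nth[of f])

lemma D_mult_le:
  assumes "f \<in> carrier P" "g \<in> carrier P" "deg R f \<le> n"
  shows "f \<otimes>\<^bsub>D\<^esub> g = (\<Oplus>\<^bsub>P\<^esub>i \<in> {..n}. coeff P f i \<odot>\<^bsub>P\<^esub> (L ^^ i) g)"
  unfolding D_mult_coeff[OF assms(1)]
  by (rule U.P.add.finprod_mono_neutral_cong_left) (use assms in \<open>auto simp: U.deg_aboveD\<close>)

lemma D_mult_closed [simp]:
  "\<lbrakk>f \<in> carrier P; g \<in> carrier P\<rbrakk> \<Longrightarrow> f \<otimes>\<^bsub>D\<^esub> g \<in> carrier P"
  unfolding D_mult_coeff by (rule U.P.finsum_closed) auto

lemma D_l_distr:
  assumes f: "f \<in> carrier P" and f': "f' \<in> carrier P" and g: "g \<in> carrier P"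
  shows "(f \<oplus>\<^bsub>P\<^esub> f') \<otimes>\<^bsub>D\<^esub> g = f \<otimes>\<^bsub>D\<^esub> g \<oplus>\<^bsub>P\<^esub> f' \<otimes>\<^bsub>D\<^esub> g"
proof -
  define n where "n = max (deg R f) (deg R f')"
  have "deg R (f \<oplus>\<^bsub>P\<^esub> f') \<le> n" using f f' by (simp add: n_def)
  then show ?thesis
    using assms D_mult_le[OF f g, of n] D_mult_le[OF f' g, of n]
      D_mult_le[of "f \<oplus>\<^bsub>P\<^esub> f'" g n]
    by (simp add: n_def U.UP_smult_l_distr U.P.finsum_addf Pi_def cong: U.P.finsum_cong)
qed

lemma D_r_distr:
  assumes "f \<in> carrier P" "g \<in> carrier P" "g' \<in> carrier P"
  shows "f \<otimes>\<^bsub>D\<^esub> (g \<oplus>\<^bsub>P\<^esub> g') = f \<otimes>\<^bsub>D\<^esub> g \<oplus>\<^bsub>P\<^esub> f \<otimes>\<^bsub>D\<^esub> g'"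
  using assms
  by (simp add: D_mult_coeff Ln_add U.UP_smult_r_distr U.P.finsum_addf Pi_def
      cong: U.P.finsum_cong)

lemma smult_finsum:
  assumes "finite A" "a \<in> carrier R" "\<And>i. i \<in> A \<Longrightarrow> F i \<in> carrier P"
  shows "a \<odot>\<^bsub>P\<^esub> (\<Oplus>\<^bsub>P\<^esub>i \<in> A. F i) = (\<Oplus>\<^bsub>P\<^esub>i \<in> A. a \<odot>\<^bsub>P\<^esub> F i)"
  using assms(1,3)
proof (induction A rule: finite_induct)
  case empty
  show ?case using assms(2) by (auto intro: U.up_eqI)
next
  case (insert x A)
  then show ?case using assms(2) by (simp add: Pi_def U.UP_smult_r_distr)
qed

lemma L_finsum:
  assumes "finite A" "\<And>i. i \<in> A \<Longrightarrow> F i \<in> carrier P"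
  shows "L (\<Oplus>\<^bsub>P\<^esub>i \<in> A. F i) = (\<Oplus>\<^bsub>P\<^esub>i \<in> A. L (F i))"
  using assms by (induction A rule: finite_induct) (simp_all add: L_zero L_add Pi_def)

lemma D_smult_assoc:
  assumes "a \<in> carrier R" "f \<in> carrier P" "g \<in> carrier P"
  shows "(a \<odot>\<^bsub>P\<^esub> f) \<otimes>\<^bsub>D\<^esub> g = a \<odot>\<^bsub>P\<^esub> (f \<otimes>\<^bsub>D\<^esub> g)"
proof -
  have "deg R (a \<odot>\<^bsub>P\<^esub> f) \<le> deg R f"
    by (rule U.deg_aboveI) (use assms in \<open>auto simp: U.deg_aboveD\<close>)
  then show ?thesis
    using assms
    by (simp add: D_mult_le[of "a \<odot>\<^bsub>P\<^esub> f" g "deg R f"] D_mult_coeff[of f] smult_finsum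
        U.UP_smult_assoc1 Pi_def cong: U.P.finsum_cong)
qed

lemma D_L_assoc:
  assumes f: "f \<in> carrier P" and g: "g \<in> carrier P"
  shows "L f \<otimes>\<^bsub>D\<^esub> g = L (f \<otimes>\<^bsub>D\<^esub> g)"
proof -
  let ?n = "deg R f"
  let ?c = "coeff P f"
  have degL: "deg R (L f) \<le> Suc ?n"
    by (rule U.deg_aboveI) (use f in \<open>auto simp: coeff_L U.deg_aboveD split: nat.split\<close>)
  have "L f \<otimes>\<^bsub>D\<^esub> g = (\<Oplus>\<^bsub>P\<^esub>i \<in> {..Suc ?n}. coeff P (L f) i \<odot>\<^bsub>P\<^esub> (L ^^ i) g)"
    using D_mult_le[OF _ g degL] f by simp
  also have "\<dots> = (\<Oplus>\<^bsub>P\<^esub>i \<in> {..Suc ?n}.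
      (case i of 0 \<Rightarrow> \<zero> | Suc m \<Rightarrow> ?c m) \<odot>\<^bsub>P\<^esub> (L ^^ i) g \<oplus>\<^bsub>P\<^esub> \<delta> (?c i) \<odot>\<^bsub>P\<^esub> (L ^^ i) g)"
    by (rule U.P.finsum_cong') (use f g in \<open>auto simp: coeff_L U.UP_smult_l_distr split: nat.split\<close>)
  also have "\<dots> = (\<Oplus>\<^bsub>P\<^esub>i \<in> {..Suc ?n}. (case i of 0 \<Rightarrow> \<zero> | Suc m \<Rightarrow> ?c m) \<odot>\<^bsub>P\<^esub> (L ^^ i) g)
      \<oplus>\<^bsub>P\<^esub> (\<Oplus>\<^bsub>P\<^esub>i \<in> {..Suc ?n}. \<delta> (?c i) \<odot>\<^bsub>P\<^esub> (L ^^ i) g)"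
    by (rule U.P.finsum_addf) (use f g in \<open>auto split: nat.split\<close>)
  also have "(\<Oplus>\<^bsub>P\<^esub>i \<in> {..Suc ?n}. (case i of 0 \<Rightarrow> \<zero> | Suc m \<Rightarrow> ?c m) \<odot>\<^bsub>P\<^esub> (L ^^ i) g)
      = (\<Oplus>\<^bsub>P\<^esub>i \<in> {..?n}. ?c i \<odot>\<^bsub>P\<^esub> (L ^^ Suc i) g)"
    by (subst U.P.finsum_Suc2) (use f g in \<open>auto split: nat.split simp del: U.P.finsum_Suc\<close>)
  also have "(\<Oplus>\<^bsub>P\<^esub>i \<in> {..Suc ?n}. \<delta> (?c i) \<odot>\<^bsub>P\<^esub> (L ^^ i) g)
      = (\<Oplus>\<^bsub>P\<^esub>i \<in> {..?n}. \<delta> (?c i) \<odot>\<^bsub>P\<^esub> (L ^^ i) g)"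
    by (subst U.P.finsum_Suc) (use f g in \<open>auto simp: U.deg_aboveD simp del: U.P.finsum_Suc\<close>)
  also have "(\<Oplus>\<^bsub>P\<^esub>i \<in> {..?n}. ?c i \<odot>\<^bsub>P\<^esub> (L ^^ Suc i) g)
      \<oplus>\<^bsub>P\<^esub> (\<Oplus>\<^bsub>P\<^esub>i \<in> {..?n}. \<delta> (?c i) \<odot>\<^bsub>P\<^esub> (L ^^ i) g)
      = (\<Oplus>\<^bsub>P\<^esub>i \<in> {..?n}. ?c i \<odot>\<^bsub>P\<^esub> (L ^^ Suc i) g \<oplus>\<^bsub>P\<^esub> \<delta> (?c i) \<odot>\<^bsub>P\<^esub> (L ^^ i) g)"
    by (rule U.P.finsum_addf[symmetric]) (use f g in auto)
  also have "\<dots> = (\<Oplus>\<^bsub>P\<^esub>i \<in> {..?n}. L (?c i \<odot>\<^bsub>P\<^esub> (L ^^ i) g))"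
    by (rule U.P.finsum_cong') (use f g in \<open>auto simp: L_smult\<close>)
  also have "\<dots> = L (f \<otimes>\<^bsub>D\<^esub> g)"
    using f g by (simp add: D_mult_coeff L_finsum)
  finally show ?thesis .
qed

lemma D_Ln_assoc:
  "\<lbrakk>f \<in> carrier P; g \<in> carrier P\<rbrakk> \<Longrightarrow> (L ^^ i) f \<otimes>\<^bsub>D\<^esub> g = (L ^^ i) (f \<otimes>\<^bsub>D\<^esub> g)"
  by (induction i) (auto simp: D_L_assoc)

lemma D_zero_mult: "g \<in> carrier P \<Longrightarrow> \<zero>\<^bsub>P\<^esub> \<otimes>\<^bsub>D\<^esub> g = \<zero>\<^bsub>P\<^esub>"
  by (simp add: D_mult_coeff)

lemma D_finsum_mult:
  assumes "finite A" "\<And>i. i \<in> A \<Longrightarrow> F i \<in> carrier P" "g \<in> carrier P"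
  shows "(\<Oplus>\<^bsub>P\<^esub>i \<in> A. F i) \<otimes>\<^bsub>D\<^esub> g = (\<Oplus>\<^bsub>P\<^esub>i \<in> A. F i \<otimes>\<^bsub>D\<^esub> g)"
  using assms by (induction A rule: finite_induct) (simp_all add: D_zero_mult D_l_distr Pi_def)

lemma D_assoc:
  assumes f: "f \<in> carrier P" and g: "g \<in> carrier P" and h: "h \<in> carrier P"
  shows "(f \<otimes>\<^bsub>D\<^esub> g) \<otimes>\<^bsub>D\<^esub> h = f \<otimes>\<^bsub>D\<^esub> (g \<otimes>\<^bsub>D\<^esub> h)"
proof -
  have "(f \<otimes>\<^bsub>D\<^esub> g) \<otimes>\<^bsub>D\<^esub> h
      = (\<Oplus>\<^bsub>P\<^esub>i \<in> {..deg R f}. (coeff P f i \<odot>\<^bsub>P\<^esub> (L ^^ i) g) \<otimes>\<^bsub>D\<^esub> h)"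
    unfolding D_mult_coeff[OF f] by (rule D_finsum_mult) (use assms in auto)
  also have "\<dots> = (\<Oplus>\<^bsub>P\<^esub>i \<in> {..deg R f}. coeff P f i \<odot>\<^bsub>P\<^esub> (L ^^ i) (g \<otimes>\<^bsub>D\<^esub> h))"
    by (rule U.P.finsum_cong') (use assms in \<open>auto simp: D_smult_assoc D_Ln_assoc\<close>)
  also have "\<dots> = f \<otimes>\<^bsub>D\<^esub> (g \<otimes>\<^bsub>D\<^esub> h)"
    by (simp add: D_mult_coeff[OF f])
  finally show ?thesis .
qed

theorem D_mult_const: "\<lbrakk>a \<in> carrier R; g \<in> carrier P\<rbrakk> \<Longrightarrow> monom P a 0 \<otimes>\<^bsub>D\<^esub> g = a \<odot>\<^bsub>P\<^esub> g"
  by (simp add: D_mult_coeff)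

lemma D_l_one: "g \<in> carrier P \<Longrightarrow> \<one>\<^bsub>P\<^esub> \<otimes>\<^bsub>D\<^esub> g = g"
  using D_mult_const[of \<one> g] by simp

lemma D_r_one:
  assumes "f \<in> carrier P" shows "f \<otimes>\<^bsub>D\<^esub> \<one>\<^bsub>P\<^esub> = f"
proof -
  have "f \<otimes>\<^bsub>D\<^esub> \<one>\<^bsub>P\<^esub> = (\<Oplus>\<^bsub>P\<^esub>i \<in> {..deg R f}. monom P (coeff P f i) i)"
    unfolding D_mult_coeff[OF assms]
    by (rule U.P.finsum_cong')
       (use assms in \<open>auto simp: Ln_one U.monom_mult_smult[symmetric]\<close>)
  then show ?thesis using U.up_repr[OF assms] by simp
qed

theorem diff_op_ring_ring: "ring D"
proof -
  have "abelian_group D"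
    by (rule abelian_groupI) (auto simp: U.P.a_ac intro: U.UP_l_neg_ex)
  then show ?thesis
    by (intro ringI monoidI)
       (auto simp: D_assoc D_l_one D_r_one D_l_distr D_r_distr)
qed

theorem diff_op_ring_const_hom: "(\<lambda>a. monom P a 0) \<in> ring_hom R D"
  by (rule ring_hom_memI) (auto simp: D_mult_const U.monom_mult_smult)

theorem diff_op_ring_const_inj: "inj_on (\<lambda>a. monom P a 0) (carrier R)"
  by (rule U.monom_inj)

theorem diff_op_ring_commutation:
  assumes "a \<in> carrier R"
  shows "monom P \<one> 1 \<otimes>\<^bsub>D\<^esub> monom P a 0
    = monom P a 0 \<otimes>\<^bsub>D\<^esub> monom P \<one> 1 \<oplus>\<^bsub>D\<^esub> monom P (\<delta> a) 0"
proof -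
  have "monom P \<one> 1 \<otimes>\<^bsub>D\<^esub> monom P a 0 = L (monom P \<one> 0 \<otimes>\<^bsub>D\<^esub> monom P a 0)"
    using assms D_L_assoc[of "monom P \<one> 0" "monom P a 0"]
    by (simp add: L_monom del: U.monom_one)
  then show ?thesis
    using assms by (simp add: D_l_one L_monom D_mult_const U.monom_mult_smult[symmetric])
qed

theorem diff_op_ring_theta_power: "monom P \<one> 1 [^]\<^bsub>D\<^esub> n = monom P \<one> n"
proof (induction n)
  case 0
  show ?case by simp
next
  case (Suc n)
  have "monom P \<one> n \<otimes>\<^bsub>D\<^esub> monom P \<one> 1 = (L ^^ n) (\<one>\<^bsub>P\<^esub> \<otimes>\<^bsub>D\<^esub> monom P \<one> 1)"
    using D_Ln_assoc[of "\<one>\<^bsub>P\<^esub>" "monom P \<one> 1" n] by (simp add: Ln_one)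
  also have "\<dots> = (L ^^ Suc n) \<one>\<^bsub>P\<^esub>"
    using Ln_one[of 1] by (simp add: D_l_one funpow_swap1)
  finally show ?case using Suc by (simp add: Ln_one del: funpow.simps)
qed

end

end

theory Submission
  imports Defs
begin

text \<open>
  The heart of the matter is that \<open>S/I\<close> is Artinian for every nonzero left ideal \<open>I\<close> of
  \<open>S = R[\<theta>;\<delta>]\<close>. Let \<open>J' \<subseteq> J\<close> be left ideals with the same minimal degree and the same
  ideal of leading coefficients. Then \<open>J = J' + {f \<in> J. deg f < N}\<close> for some \<open>N\<close>, and dividing by
  an element of \<open>J'\<close> of minimal degree, with leading coefficient \<open>c\<close>, gives \<open>c\<^sup>N J \<subseteq> J'\<close>.
  So the annihilator of \<open>J/J'\<close> in \<open>R\<close> is nonzero; it is a \<open>\<delta>\<close>-ideal because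
  \<open>\<delta>(r) = \<theta>r - r\<theta>\<close>, hence it is \<open>R\<close> and \<open>J = J'\<close>. In a descending chain of left ideals above
  \<open>I \<noteq> 0\<close> the minimal degrees are bounded, and the ideals of leading coefficients stabilize because
  \<open>R\<close> modulo a nonzero ideal is Artinian.

  For a cyclic module \<open>M = Sx\<close> it remains to exclude \<open>ann x = 0\<close>. In that case a simple submodule
  corresponds to a minimal left ideal \<open>Sf\<close> with \<open>f \<noteq> 0\<close>, so \<open>f \<in> S\<theta>f\<close>, which is impossible
  for degree reasons.
\<close>

section \<open>Chain conditions for ideals of the coefficient ring\<close>

text \<open>In a Noetherian ring a nonempty chain of ideals contains its own union, so the upper
  bound that Zorn's lemma asks for lies in \<open>X\<close> again.\<close>

lemma (in noetherian_ring) exists_maximal_in: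
  assumes "X \<noteq> {}" "\<And>I. I \<in> X \<Longrightarrow> ideal I R"
  shows "\<exists>I \<in> X. \<forall>J \<in> X. I \<subseteq> J \<longrightarrow> J = I"
proof (rule subset_Zorn_nonempty[OF assms(1)])
  fix C assume C: "C \<noteq> {}" "subset.chain X C"
  then have "subset.chain {I. ideal I R} C"
    using assms(2) by (auto simp: subset.chain_def)
  then have "\<Union>C \<in> C" by (rule ideal_chain_is_trivial[OF C(1)])
  with C(2) show "\<Union>C \<in> X" by (auto simp: subset.chain_def)
qed

lemma (in noetherian_ring) ascending_ideals_stabilize:
  fixes B :: "nat \<Rightarrow> 'a set"
  assumes "\<And>i. ideal (B i) R" "\<And>i. B i \<subseteq> B (Suc i)"
  shows "\<exists>k. \<forall>i\<ge>k. B i = B k"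
proof -
  obtain k where k: "\<And>i. B k \<subseteq> B i \<Longrightarrow> B i = B k"
    using exists_maximal_in[of "range B"] assms(1) by auto
  have "B k \<subseteq> B i" if "k \<le> i" for i
    using lift_Suc_mono_le[of B k i] assms(2) that by blast
  with k show ?thesis by blast
qed

lemma (in ring) additive_subgroup_minusI:
  assumes "H \<subseteq> carrier R" "H \<noteq> {}" "\<And>a b. \<lbrakk>a \<in> H; b \<in> H\<rbrakk> \<Longrightarrow> a \<ominus> b \<in> H"
  shows "additive_subgroup H R"
proof (rule additive_subgroup.intro, rule add.subgroupI)
  have z: "\<zero> \<in> H"
    using assms by (metis equals0I r_neg minus_eq subsetD)
  show n: "\<ominus> a \<in> H" if "a \<in> H" for a
    using assms(3)[OF z that] assms(1) that by (auto simp: minus_eq)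
  show "a \<oplus> b \<in> H" if "a \<in> H" "b \<in> H" for a b
    using assms(3)[OF that(1) n[OF that(2)]] assms(1) that by (auto simp: minus_eq subset_iff)
qed (use assms in auto)

lemma (in cring) cring_idealI:
  assumes "H \<subseteq> carrier R" "H \<noteq> {}" "\<And>a b. \<lbrakk>a \<in> H; b \<in> H\<rbrakk> \<Longrightarrow> a \<ominus> b \<in> H"
    and "\<And>a x. \<lbrakk>a \<in> H; x \<in> carrier R\<rbrakk> \<Longrightarrow> x \<otimes> a \<in> H"
  shows "ideal H R"
proof (rule idealI[OF ring_axioms])
  show "subgroup H (add_monoid R)"
    using additive_subgroup.a_subgroup[OF additive_subgroup_minusI] assms by simp
  fix a x assume "a \<in> H" "x \<in> carrier R"
  then show "x \<otimes> a \<in> H" "a \<otimes> x \<in> H" using assms(1,4) m_comm by (auto simp: subset_iff)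
qed

text \<open>An ideal strictly between \<open>A\<close> and the ring would lie in a maximal ideal
  \<open>m\<close>, and \<open>{\<zero>} \<subset> A \<subset> m\<close> would be a chain of primes
  of length 2.\<close>

lemma (in noetherian_domain) nonzero_prime_maximal:
  assumes dim: "krull_dim R \<le> 1" and A: "primeideal A R" "A \<noteq> {\<zero>}"
    and I: "ideal I R" "A \<subseteq> I"
  shows "I = A \<or> I = carrier R"
proof (rule ccontr)
  assume neg: "\<not> ?thesis"
  let ?X = "{J. ideal J R \<and> I \<subseteq> J \<and> J \<noteq> carrier R}"
  have "\<exists>m \<in> ?X. \<forall>J \<in> ?X. m \<subseteq> J \<longrightarrow> J = m"
    by (rule exists_maximal_in) (use neg I in auto)
  then obtain m where m: "ideal m R" "I \<subseteq> m" "m \<noteq> carrier R"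
    "\<And>J. \<lbrakk>ideal J R; m \<subseteq> J; J \<noteq> carrier R\<rbrakk> \<Longrightarrow> J = m"
    by (metis (mono_tags, lifting) mem_Collect_eq order_trans)
  have "maximalideal m R" by (rule maximalidealI) (use m in auto)
  then have pm: "primeideal m R" by (rule maximalideal_prime)
  \<comment> \<open>The chain is continued by the constant value \<open>m\<close>, so that every
    \<open>?P i\<close> is prime; strictness matters only for \<open>i < 2\<close>.\<close>
  let ?P = "\<lambda>i::nat. if i = 0 then {\<zero>} else if i = 1 then A else m"
  have "{\<zero>} \<subset> A"
    using A additive_subgroup.zero_closed[OF ideal.axioms(1)[OF primeideal.axioms(1)]] by blast
  moreover have "A \<subset> m" using neg I m(2,3) by blast
  ultimately have "?P i \<subset> ?P (Suc i)" if "i < 2" for i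
    using that by (cases i) auto
  moreover have "primeideal (?P i) R" for i
    using A pm zeroprimeideal by simp
  ultimately have "enat 2 \<le> krull_dim R"
    unfolding krull_dim_def by (intro Sup_upper CollectI exI[of _ 2] exI[of _ ?P] conjI) simp_all
  with dim have "enat 2 \<le> enat 1" by (metis one_enat_def order_trans)
  then show False by simp
qed

text \<open>Noetherian induction: let \<open>Q\<close> be maximal among the nonzero ideals modulo
  which the descending chain condition fails. It is not prime by the bound on the dimension, so
  \<open>x \<otimes> y \<in> Q\<close> for some \<open>x\<close>, \<open>y\<close> outside
  \<open>Q\<close>. Then \<open>Q + Rx\<close> and the colon ideal \<open>(Q : x)\<close> are
  strictly larger than \<open>Q\<close>, the first because of \<open>x\<close>, the second because
  of \<open>y\<close>. The chain condition above these two forces it above \<open>Q\<close>.\<close>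

lemma (in noetherian_domain) descending_ideals_stabilize:
  fixes B :: "nat \<Rightarrow> 'a set"
  assumes dim: "krull_dim R \<le> 1" and A: "ideal A R" "A \<noteq> {\<zero>}"
    and B: "\<And>i. ideal (B i) R" "\<And>i. A \<subseteq> B i" "\<And>i. B (Suc i) \<subseteq> B i"
  shows "\<exists>k. \<forall>i\<ge>k. B i = B k"
proof (rule ccontr)
  assume neg: "\<not> ?thesis"
  \<comment> \<open>This says that \<open>R/A\<close> is Artinian, without forming the
    quotient.\<close>
  define dcc where "dcc A \<longleftrightarrow> (\<forall>B :: nat \<Rightarrow> 'a set. (\<forall>i. ideal (B i) R \<and> A \<subseteq> B i \<and> B (Suc i) \<subseteq> B i)
     \<longrightarrow> (\<exists>k. \<forall>i\<ge>k. B i = B k))" for A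
  let ?X = "{A. ideal A R \<and> A \<noteq> {\<zero>} \<and> \<not> dcc A}"
  have "\<not> dcc A" using B neg unfolding dcc_def by blast
  then have "A \<in> ?X" using A by blast
  then have "\<exists>Q \<in> ?X. \<forall>J \<in> ?X. Q \<subseteq> J \<longrightarrow> J = Q"
    by (intro exists_maximal_in) auto
  then obtain Q where Q: "ideal Q R" "Q \<noteq> {\<zero>}" "\<not> dcc Q"
    and max: "\<forall>J \<in> ?X. Q \<subseteq> J \<longrightarrow> J = Q"
    by blast
  interpret Q: ideal Q R by (rule Q(1))
  have Qmax: "dcc J" if J: "ideal J R" "Q \<subset> J" for J
  proof (rule ccontr)
    assume "\<not> dcc J"
    moreover have "J \<noteq> {\<zero>}" using J(2) Q(2) Q.zero_closed by blast
    ultimately show False using max J by blast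
  qed
  obtain C :: "nat \<Rightarrow> 'a set" where C: "\<And>i. ideal (C i) R" "\<And>i. Q \<subseteq> C i"
    "\<And>i. C (Suc i) \<subseteq> C i" and nC: "\<not> (\<exists>k. \<forall>i\<ge>k. C i = C k)"
    using Q(3) unfolding dcc_def by blast
  have anti: "C j \<subseteq> C i" if "i \<le> j" for i j
    using lift_Suc_antimono_le[of C i j] C(3) that by blast
  \<comment> \<open>Above a nonzero prime \<open>Q\<close> there are only \<open>Q\<close> and
    \<open>R\<close>, so the chain either reaches \<open>Q\<close> and stays there or is constantly
    \<open>R\<close>.\<close>
  have "\<not> primeideal Q R"
  proof
    assume "primeideal Q R"
    then have *: "C i = Q \<or> C i = carrier R" for i
      using nonzero_prime_maximal[OF dim _ Q(2) C(1) C(2)] by blast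
    show False
    proof (cases "\<exists>k. C k = Q")
      case True
      then obtain k where "C k = Q" ..
      then have "\<forall>i\<ge>k. C i = C k" using anti C(2) by blast
      then show False using nC by blast
    next
      case False
      then show False using * nC by metis
    qed
  qed
  moreover have "carrier R \<noteq> Q"
  proof
    assume "carrier R = Q"
    then have "C i = Q" for i
      using C(2)[of i] additive_subgroup.a_subset[OF ideal.axioms(1)[OF C(1)]] by blast
    then show False using nC by blast
  qed
  ultimately obtain x y where xy: "x \<in> carrier R" "y \<in> carrier R" "x \<otimes> y \<in> Q" "x \<notin> Q" "y \<notin> Q"
    using primeidealI[OF Q(1) is_cring] by blast
  have subC: "c \<in> carrier R" if "c \<in> C i" for c i
    using that additive_subgroup.a_subset[OF ideal.axioms(1)[OF C(1)]] by blast
  \<comment> \<open>\<open>D i\<close> is \<open>C i + Rx\<close> and \<open>E i\<close> is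
    \<open>(C i : x)\<close>. These are the two ends of the exact sequence \<open>0 \<rightarrow>
    R/(C i : x) \<rightarrow> R/C i \<rightarrow> R/(C i + Rx) \<rightarrow> 0\<close>, whose first
    map is multiplication by \<open>x\<close>.\<close>
  define D where "D i = set_add R (C i) (PIdl x)" for i
  define E where "E i = {r \<in> carrier R. r \<otimes> x \<in> C i}" for i
  have D_mem: "d \<in> D i \<longleftrightarrow> (\<exists>c \<in> C i. \<exists>r \<in> carrier R. d = c \<oplus> r \<otimes> x)" for d i
    by (auto simp: D_def set_add_def' cgenideal_def)
  have colon: "ideal {r \<in> carrier R. r \<otimes> x \<in> I} R" if I: "ideal I R" for I
  proof -
    interpret I: ideal I R by (rule I)
    have "\<zero> \<in> {r \<in> carrier R. r \<otimes> x \<in> I}" using xy(1) by simp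
    moreover have "(a \<ominus> b) \<otimes> x \<in> I"
      if "a \<in> carrier R" "b \<in> carrier R" "a \<otimes> x \<in> I" "b \<otimes> x \<in> I" for a b
      using that xy(1) by (simp add: minus_eq l_distr l_minus)
    ultimately show ?thesis
      by (intro cring_idealI) (use xy(1) in \<open>auto simp: m_assoc intro: I.I_l_closed\<close>)
  qed
  have "dcc (set_add R Q (PIdl x))"
  proof (rule Qmax)
    show "ideal (set_add R Q (PIdl x)) R" using Q(1) xy(1) cgenideal_ideal add_ideals by blast
    have "x = \<zero> \<oplus> \<one> \<otimes> x" using xy(1) by simp
    then have "x \<in> set_add R Q (PIdl x)" by (force simp: set_add_def' cgenideal_def)
    moreover have "q \<in> set_add R Q (PIdl x)" if "q \<in> Q" for q
    proof -
      have "q = q \<oplus> \<zero> \<otimes> x" using xy(1) that Q.a_subset by auto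
      then show ?thesis using that by (force simp: set_add_def' cgenideal_def)
    qed
    ultimately show "Q \<subset> set_add R Q (PIdl x)" using xy(4) by blast
  qed
  moreover have "ideal (D i) R \<and> set_add R Q (PIdl x) \<subseteq> D i \<and> D (Suc i) \<subseteq> D i" for i
    using C(2)[of i] C(3)[of i] add_ideals[OF C(1) cgenideal_ideal[OF xy(1)]]
    unfolding D_def set_add_def' by blast
  ultimately obtain k where k: "\<And>i. i \<ge> k \<Longrightarrow> D i = D k"
    unfolding dcc_def by blast
  have "dcc {r \<in> carrier R. r \<otimes> x \<in> Q}"
  proof (rule Qmax[OF colon[OF Q(1)]])
    have "y \<otimes> x \<in> Q" using xy m_comm by simp
    then show "Q \<subset> {r \<in> carrier R. r \<otimes> x \<in> Q}"
      using xy Q.I_r_closed Q.a_subset by blast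
  qed
  moreover have "ideal (E i) R \<and> {r \<in> carrier R. r \<otimes> x \<in> Q} \<subseteq> E i \<and> E (Suc i) \<subseteq> E i" for i
    using C(2)[of i] C(3)[of i] colon[OF C(1)] unfolding E_def by blast
  ultimately obtain l where l: "\<And>i. i \<ge> l \<Longrightarrow> E i = E l"
    unfolding dcc_def by blast
  define n where "n = max k l"
  \<comment> \<open>Write \<open>b \<in> C n\<close> as \<open>c \<oplus> r \<otimes> x\<close> with
    \<open>c \<in> C i\<close>, using \<open>D n = D i\<close>. Since
    \<open>C i \<subseteq> C n\<close>, the term \<open>r \<otimes> x\<close> lies in
    \<open>C n\<close>, and \<open>E n = E i\<close> moves it into \<open>C i\<close>.\<close>
  have "C n \<subseteq> C i" if i: "i \<ge> n" for i
  proof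
    fix b assume b: "b \<in> C n"
    have bc: "b \<in> carrier R" using b subC by blast
    have "b = b \<oplus> \<zero> \<otimes> x" using xy(1) bc by simp
    then have "b \<in> D n" using D_mem b by blast
    then have "b \<in> D i" using k[of n] k[of i] i by (simp add: n_def)
    then obtain c r where cr: "c \<in> C i" "r \<in> carrier R" "b = c \<oplus> r \<otimes> x" using D_mem by blast
    interpret Cn: ideal "C n" R by (rule C(1))
    interpret Ci: ideal "C i" R by (rule C(1))
    have "r \<otimes> x = b \<oplus> \<ominus> c"
      using cr xy(1) subC[OF cr(1)] by algebra
    moreover have "c \<in> C n" using cr(1) anti[OF i] by blast
    ultimately have "r \<otimes> x \<in> C n" using b by simp
    then have "r \<in> E n" using cr(2) by (simp add: E_def)
    then have "r \<in> E i" using l[of n] l[of i] i by (simp add: n_def)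
    then show "b \<in> C i" using cr by (simp add: E_def)
  qed
  then have "\<forall>i\<ge>n. C i = C n" using anti by blast
  then show False using nC by blast
qed

context derivation
begin

interpretation U: UP_cring R "UP R"
  by unfold_locales simp

text \<open>\<open>D\<close> and \<open>UP R\<close> share carrier and addition, so additive
  arguments about ideals of \<open>D\<close> can be carried out among polynomials.\<close>

lemma additive_subgroup_D: "additive_subgroup J D \<longleftrightarrow> additive_subgroup J P"
  by (simp add: additive_subgroup_def subgroup_def m_inv_def)

lemma additive_subgroup_P_minus:
  assumes J: "additive_subgroup J P" and "f \<in> J" "g \<in> J"
  shows "f \<ominus>\<^bsub>P\<^esub> g \<in> J"
proof -
  have "\<ominus>\<^bsub>P\<^esub> g \<in> J"
    using subgroup.m_inv_closed[OF additive_subgroup.a_subgroup[OF J] assms(3)]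
    by (simp add: a_inv_def)
  then show ?thesis
    using additive_subgroup.a_closed[OF J assms(2)] by (simp add: a_minus_def)
qed

text \<open>Each application of \<open>L\<close> shifts the coefficients up by one degree; the added
  \<delta>-term lives in the old degrees and cannot reach the new top. Here \<open>n\<close> is only
  a bound on the degree.\<close>

lemma coeff_Ln_top:
  assumes g: "g \<in> carrier P" "\<And>k. k > n \<Longrightarrow> coeff P g k = \<zero>"
  shows "(\<forall>k > i + n. coeff P ((L ^^ i) g) k = \<zero>) \<and> coeff P ((L ^^ i) g) (i + n) = coeff P g n"
proof (induction i)
  case 0
  show ?case using g by simp
next
  case (Suc i)
  then show ?case using g by (auto simp: coeff_L split: nat.split)
qed

text \<open>Only the summand \<open>i = m\<close> of \<open>f\<close> can reach degree
  \<open>m + n\<close>, and \<delta> contributes only below the top. With degree bounds in place of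
  degrees, no coefficient has to be nonzero.\<close>

lemma D_mult_top:
  assumes f: "f \<in> carrier P" "\<And>k. k > m \<Longrightarrow> coeff P f k = \<zero>"
    and g: "g \<in> carrier P" "\<And>k. k > n \<Longrightarrow> coeff P g k = \<zero>"
  shows "k > m + n \<Longrightarrow> coeff P (f \<otimes>\<^bsub>D\<^esub> g) k = \<zero>"
    and "coeff P (f \<otimes>\<^bsub>D\<^esub> g) (m + n) = coeff P f m \<otimes> coeff P g n"
proof -
  note top = coeff_Ln_top[OF g]
  have "deg R f \<le> m" using f by (intro U.deg_aboveI)
  then have eq: "coeff P (f \<otimes>\<^bsub>D\<^esub> g) k = (\<Oplus>i \<in> {..m}. coeff P f i \<otimes> coeff P ((L ^^ i) g) k)" for k
    using f g by (simp add: D_mult_le U.coeff_finsum Pi_def cong: R.finsum_cong)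
  show "coeff P (f \<otimes>\<^bsub>D\<^esub> g) k = \<zero>" if "k > m + n"
  proof -
    have "coeff P (f \<otimes>\<^bsub>D\<^esub> g) k = (\<Oplus>i \<in> {..m}. \<zero>)"
      unfolding eq by (rule R.finsum_cong') (use f g that top in auto)
    then show ?thesis by simp
  qed
  have "coeff P (f \<otimes>\<^bsub>D\<^esub> g) (m + n)
      = (\<Oplus>i \<in> {..m}. if m = i then coeff P f i \<otimes> coeff P ((L ^^ i) g) (m + n) else \<zero>)"
    unfolding eq by (rule R.finsum_cong') (use f g top in auto)
  also have "\<dots> = coeff P f m \<otimes> coeff P ((L ^^ m) g) (m + n)"
    by (rule R.finsum_singleton) (use f g in auto)
  also have "\<dots> = coeff P f m \<otimes> coeff P g n" using top by simp
  finally show "coeff P (f \<otimes>\<^bsub>D\<^esub> g) (m + n) = coeff P f m \<otimes> coeff P g n" .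
qed

text \<open>Contains \<open>0\<close> and, by admitting \<open>f\<close> of degree below \<open>n\<close>, is closed under subtraction.\<close>

definition lcoeffs :: "(nat \<Rightarrow> 'a) set \<Rightarrow> nat \<Rightarrow> 'a set" where
  "lcoeffs J n = {coeff P f n | f. f \<in> J \<and> (\<forall>k>n. coeff P f k = \<zero>)}"

lemma lcoeffsI:
  "\<lbrakk>f \<in> J; \<And>k. k > n \<Longrightarrow> coeff P f k = \<zero>\<rbrakk> \<Longrightarrow> coeff P f n \<in> lcoeffs J n"
  by (auto simp: lcoeffs_def)

lemma lcoeffs_mono: "J \<subseteq> J' \<Longrightarrow> lcoeffs J n \<subseteq> lcoeffs J' n"
  by (auto simp: lcoeffs_def)

text \<open>The common ground of left and right ideals of \<open>R[\<theta>;\<delta>]\<close>.\<close>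

definition lcoeffs_stable :: "(nat \<Rightarrow> 'a) set \<Rightarrow> bool" where
  "lcoeffs_stable J \<longleftrightarrow> additive_subgroup J P \<and>
     (\<forall>n. \<forall>a \<in> carrier R. \<forall>c \<in> lcoeffs J n. a \<otimes> c \<in> lcoeffs J n) \<and> (\<forall>n. lcoeffs J n \<subseteq> lcoeffs J (Suc n))"

lemma lcoeffs_subset: "additive_subgroup J P \<Longrightarrow> lcoeffs J n \<subseteq> carrier R"
  using additive_subgroup.a_subset[of J P] by (auto simp: lcoeffs_def)

lemma lcoeffs_ideal:
  assumes "lcoeffs_stable J" shows "ideal (lcoeffs J n) R"
proof (rule R.cring_idealI)
  have J: "additive_subgroup J P" using assms by (simp add: lcoeffs_stable_def)
  have sub: "f \<in> carrier P" if "f \<in> J" for f using additive_subgroup.a_subset[OF J] that by blast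
  show "lcoeffs J n \<subseteq> carrier R" by (rule lcoeffs_subset[OF J])
  have "coeff P \<zero>\<^bsub>P\<^esub> n \<in> lcoeffs J n"
    by (rule lcoeffsI) (use additive_subgroup.zero_closed[OF J] in auto)
  then show "lcoeffs J n \<noteq> {}" by blast
  show "a \<ominus> b \<in> lcoeffs J n" if ab: "a \<in> lcoeffs J n" "b \<in> lcoeffs J n" for a b
  proof -
    obtain f g where f: "f \<in> J" "\<forall>k>n. coeff P f k = \<zero>" "a = coeff P f n"
      and g: "g \<in> J" "\<forall>k>n. coeff P g k = \<zero>" "b = coeff P g n"
      using ab by (auto simp: lcoeffs_def)
    have "f \<ominus>\<^bsub>P\<^esub> g \<in> J" using f g J additive_subgroup_P_minus by blast
    moreover have "\<forall>k>n. coeff P (f \<ominus>\<^bsub>P\<^esub> g) k = \<zero>" using f g sub by simp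
    moreover have "a \<ominus> b = coeff P (f \<ominus>\<^bsub>P\<^esub> g) n" using f g sub by simp
    ultimately show ?thesis unfolding lcoeffs_def by blast
  qed
  show "x \<otimes> a \<in> lcoeffs J n" if "a \<in> lcoeffs J n" "x \<in> carrier R" for a x
    using assms that by (simp add: lcoeffs_stable_def)
qed

lemma lcoeffs_Suc_mono: "lcoeffs_stable J \<Longrightarrow> m \<le> n \<Longrightarrow> lcoeffs J m \<subseteq> lcoeffs J n"
  using lift_Suc_mono_le[of "lcoeffs J" m n] by (auto simp: lcoeffs_stable_def)

text \<open>Left multiplication by a constant scales the leading coefficient, and left
  multiplication by \<theta> carries it unchanged to the next degree.\<close>

lemma left_ideal_lcoeffs_stable:
  assumes "left_ideal D J" shows "lcoeffs_stable J"
  unfolding lcoeffs_stable_def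
proof (intro conjI allI ballI subsetI)
  show J: "additive_subgroup J P"
    using assms by (simp add: left_ideal_def additive_subgroup_D)
  fix n c assume "c \<in> lcoeffs J n"
  then obtain f where f: "f \<in> J" "\<And>k. k > n \<Longrightarrow> coeff P f k = \<zero>" "c = coeff P f n"
    by (auto simp: lcoeffs_def)
  have fP: "f \<in> carrier P" using additive_subgroup.a_subset[OF J] f by blast
  have J': "h \<otimes>\<^bsub>D\<^esub> f \<in> J" if "h \<in> carrier P" for h
    using assms that f by (simp add: left_ideal_def)
  have top: "coeff P h m \<otimes> c \<in> lcoeffs J (m + n)" if "h \<in> carrier P" "\<And>k. k > m \<Longrightarrow> coeff P h k = \<zero>" for h m
  proof -
    have "coeff P (h \<otimes>\<^bsub>D\<^esub> f) (m + n) \<in> lcoeffs J (m + n)"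
      by (rule lcoeffsI[OF J'[OF that(1)]]) (rule D_mult_top(1)[OF that fP f(2)])
    then show ?thesis using D_mult_top(2)[OF that fP f(2)] f(3) by simp
  qed
  show "a \<otimes> c \<in> lcoeffs J n" if "a \<in> carrier R" for a
    using top[of "monom P a 0" 0] that by simp
  show "c \<in> lcoeffs J (Suc n)"
    using top[of "monom P \<one> 1" 1] f(3) fP by simp
qed

text \<open>Passing to leading coefficients forgets \<delta>, so multiplication from the right acts
  on them as from the left, up to commutativity of \<open>R\<close>.\<close>

lemma right_ideal_lcoeffs_stable:
  assumes "right_ideal D J" shows "lcoeffs_stable J"
  unfolding lcoeffs_stable_def
proof (intro conjI allI ballI subsetI)
  show J: "additive_subgroup J P"
    using assms by (simp add: right_ideal_def additive_subgroup_D)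
  fix n c assume "c \<in> lcoeffs J n"
  then obtain f where f: "f \<in> J" "\<And>k. k > n \<Longrightarrow> coeff P f k = \<zero>" "c = coeff P f n"
    by (auto simp: lcoeffs_def)
  have fP: "f \<in> carrier P" using additive_subgroup.a_subset[OF J] f by blast
  have J': "f \<otimes>\<^bsub>D\<^esub> h \<in> J" if "h \<in> carrier P" for h
    using assms that f by (simp add: right_ideal_def)
  have top: "c \<otimes> coeff P h m \<in> lcoeffs J (n + m)" if "h \<in> carrier P" "\<And>k. k > m \<Longrightarrow> coeff P h k = \<zero>" for h m
  proof -
    have "coeff P (f \<otimes>\<^bsub>D\<^esub> h) (n + m) \<in> lcoeffs J (n + m)"
      by (rule lcoeffsI[OF J'[OF that(1)]]) (rule D_mult_top(1)[OF fP f(2) that])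
    then show ?thesis using D_mult_top(2)[OF fP f(2) that] f(3) by simp
  qed
  show "a \<otimes> c \<in> lcoeffs J n" if "a \<in> carrier R" for a
    using top[of "monom P a 0" 0] that f(3) fP by (simp add: R.m_comm)
  show "c \<in> lcoeffs J (Suc n)"
    using top[of "monom P \<one> 1" 1] f(3) fP by simp
qed

text \<open>As long as the degree is at least \<open>N\<close>, the leading coefficient also occurs
  in \<open>J'\<close> in the same degree, and subtracting that element lowers the degree.\<close>

lemma reduce_modulo:
  assumes J: "additive_subgroup J P" and J': "additive_subgroup J' P" "J' \<subseteq> J"
    and lcoeffs: "\<And>n. n \<ge> N \<Longrightarrow> lcoeffs J n \<subseteq> lcoeffs J' n" and f: "f \<in> J"
  shows "\<exists>h \<in> J'. f \<ominus>\<^bsub>P\<^esub> h \<in> J \<and> (\<forall>k\<ge>N. coeff P (f \<ominus>\<^bsub>P\<^esub> h) k = \<zero>)"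
proof -
  have sub: "f \<in> carrier P" if "f \<in> J" for f using additive_subgroup.a_subset[OF J] that by blast
  have "\<exists>h \<in> J'. f \<ominus>\<^bsub>P\<^esub> h \<in> J \<and> (\<forall>k\<ge>N. coeff P (f \<ominus>\<^bsub>P\<^esub> h) k = \<zero>)"
    if "f \<in> J" "\<forall>k\<ge>N + m. coeff P f k = \<zero>" for f m
    using that
  proof (induction m arbitrary: f)
    case 0
    then show ?case
      using additive_subgroup.zero_closed[OF J'(1)] sub[of f]
      by (intro bexI[of _ "\<zero>\<^bsub>P\<^esub>"]) (auto simp: a_minus_def)
  next
    case (Suc m)
    have "coeff P f (N + m) \<in> lcoeffs J (N + m)"
      by (rule lcoeffsI) (use Suc.prems in auto)
    then have "coeff P f (N + m) \<in> lcoeffs J' (N + m)" using lcoeffs[of "N + m"] by auto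
    then obtain h where h: "h \<in> J'" "\<forall>k>N + m. coeff P h k = \<zero>"
      "coeff P f (N + m) = coeff P h (N + m)" by (auto simp: lcoeffs_def)
    have hJ: "h \<in> J" using h J' by blast
    have fh: "f \<ominus>\<^bsub>P\<^esub> h \<in> J" using Suc.prems hJ J additive_subgroup_P_minus by blast
    have "coeff P (f \<ominus>\<^bsub>P\<^esub> h) k = \<zero>" if "k \<ge> N + m" for k
      using that Suc.prems h hJ sub by (cases "k = N + m") auto
    then obtain h' where h': "h' \<in> J'" "f \<ominus>\<^bsub>P\<^esub> h \<ominus>\<^bsub>P\<^esub> h' \<in> J"
      "\<forall>k\<ge>N. coeff P (f \<ominus>\<^bsub>P\<^esub> h \<ominus>\<^bsub>P\<^esub> h') k = \<zero>"
      using Suc.IH[OF fh] by blast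
    have "f \<ominus>\<^bsub>P\<^esub> h \<ominus>\<^bsub>P\<^esub> h' = f \<ominus>\<^bsub>P\<^esub> (h \<oplus>\<^bsub>P\<^esub> h')"
      using sub Suc.prems(1) hJ h'(1) J'(2)
      by (simp add: a_minus_def U.P.minus_add U.P.a_assoc subset_iff)
    then show ?case
      using h' additive_subgroup.a_closed[OF J'(1) h(1) h'(1)] by auto
  qed
  \<comment> \<open>The successor makes \<open>N + m\<close> exceed the degree of \<open>f\<close>
    even when \<open>N = 0\<close>.\<close>
  from this[of f "Suc (deg R f)"] show ?thesis
    using f sub[OF f] by (simp add: U.deg_aboveD)
qed

text \<open>Reduction modulo \<open>J'\<close> with \<open>N = 0\<close> leaves a remainder without
  any nonzero coefficient.\<close>

lemma lcoeffs_determines: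
  assumes J: "additive_subgroup J P" and J': "additive_subgroup J' P" "J' \<subseteq> J"
    and lcoeffs: "\<And>n. lcoeffs J n \<subseteq> lcoeffs J' n"
  shows "J = J'"
proof -
  have "f \<in> J'" if f: "f \<in> J" for f
  proof -
    obtain h where h: "h \<in> J'" "\<forall>k. coeff P (f \<ominus>\<^bsub>P\<^esub> h) k = \<zero>"
      using reduce_modulo[OF J J' _ f, of 0] lcoeffs by auto
    have hf: "h \<in> carrier P" "f \<in> carrier P"
      using h f J' additive_subgroup.a_subset[OF J] by blast+
    have "f \<ominus>\<^bsub>P\<^esub> h = \<zero>\<^bsub>P\<^esub>" using h hf by (intro U.up_eqI) auto
    then show ?thesis using hf h by simp
  qed
  then show ?thesis using J'(2) by blast
qed

section \<open>Noetherianity of \<open>R[\<theta>;\<delta>]\<close>\<close>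

text \<open>This is the argument of Hilbert's basis theorem. The ideals
  \<open>lcoeffs (I i) n\<close> increase in both \<open>i\<close> and \<open>n\<close>; stability
  of the diagonal from \<open>N\<close> on controls all degrees \<open>n \<ge> N\<close>, and the
  finitely many smaller degrees are treated one by one.\<close>

lemma lcoeffs_stable_chain_stabilizes:
  fixes I :: "nat \<Rightarrow> (nat \<Rightarrow> 'a) set"
  assumes "noetherian_ring R" and I: "\<And>i. lcoeffs_stable (I i)" "\<And>i. I i \<subseteq> I (Suc i)"
  shows "\<exists>k. \<forall>i\<ge>k. I i = I k"
proof -
  interpret N: noetherian_ring R by fact
  have mono: "I i \<subseteq> I j" if "i \<le> j" for i j
    using lift_Suc_mono_le[of I i j] I(2) that by blast
  have lcm: "lcoeffs (I i) m \<subseteq> lcoeffs (I j) n" if "i \<le> j" "m \<le> n" for i j m n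
    using lcoeffs_mono[OF mono[OF that(1)]] lcoeffs_Suc_mono[OF I(1) that(2)] by blast
  have "\<exists>k. \<forall>i\<ge>k. lcoeffs (I i) i = lcoeffs (I k) k"
    by (rule N.ascending_ideals_stabilize) (simp_all add: lcoeffs_ideal I lcm)
  then obtain N where N: "\<And>i. i \<ge> N \<Longrightarrow> lcoeffs (I i) i = lcoeffs (I N) N" by blast
  have "\<exists>k. \<forall>i\<ge>k. lcoeffs (I i) n = lcoeffs (I k) n" for n
    by (rule N.ascending_ideals_stabilize) (simp_all add: lcoeffs_ideal I lcm)
  then obtain k where k: "\<And>n i. i \<ge> k n \<Longrightarrow> lcoeffs (I i) n = lcoeffs (I (k n)) n" by metis
  \<comment> \<open>The sum serves as a common upper bound for \<open>N\<close> and all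
    \<open>k n\<close> with \<open>n < N\<close>.\<close>
  define K where "K = N + (\<Sum>n<N. k n)"
  have "I i = I K" if i: "i \<ge> K" for i
  proof (rule lcoeffs_determines)
    fix n
    show "lcoeffs (I i) n \<subseteq> lcoeffs (I K) n"
    proof (cases "n < N")
      case True
      then have "k n \<le> K" using member_le_sum[of n "{..<N}" k] by (simp add: K_def)
      then show ?thesis using k[of n i] k[of n K] i by simp
    next
      case False
      \<comment> \<open>For \<open>n \<ge> N\<close> both sides are compared with the diagonal,
        which is constant beyond \<open>N\<close>.\<close>
      have "lcoeffs (I i) n \<subseteq> lcoeffs (I (max i n)) (max i n)" by (rule lcm) auto
      also have "\<dots> = lcoeffs (I N) N" using False by (intro N) simp
      also have "\<dots> \<subseteq> lcoeffs (I K) n" by (rule lcm) (use False in \<open>auto simp: K_def\<close>)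
      finally show ?thesis .
    qed
  qed (use I mono[OF i] in \<open>auto simp: lcoeffs_stable_def\<close>)
  then show ?thesis by blast
qed

lemma nc_noetherian_D:
  assumes "noetherian_ring R" shows "nc_noetherian D"
  unfolding nc_noetherian_def
proof (intro conjI allI impI)
  show "ring D" by (rule diff_op_ring_ring)
  fix I :: "nat \<Rightarrow> (nat \<Rightarrow> 'a) set"
  assume "(\<forall>i. left_ideal D (I i)) \<and> (\<forall>i. I i \<subseteq> I (Suc i))"
  then show "\<exists>k. \<forall>i\<ge>k. I i = I k"
    by (intro lcoeffs_stable_chain_stabilizes[OF assms] left_ideal_lcoeffs_stable) simp_all
next
  fix I :: "nat \<Rightarrow> (nat \<Rightarrow> 'a) set"
  assume "(\<forall>i. right_ideal D (I i)) \<and> (\<forall>i. I i \<subseteq> I (Suc i))"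
  then show "\<exists>k. \<forall>i\<ge>k. I i = I k"
    by (intro lcoeffs_stable_chain_stabilizes[OF assms] right_ideal_lcoeffs_stable) simp_all
qed

section \<open>Descending chains of left ideals\<close>

lemma left_ideal_additive: "left_ideal D J \<Longrightarrow> additive_subgroup J P"
  by (simp add: left_ideal_def additive_subgroup_D)

lemma left_ideal_subset: "left_ideal D J \<Longrightarrow> J \<subseteq> carrier P"
  by (rule additive_subgroup.a_subset[OF left_ideal_additive])

lemma left_ideal_mult: "\<lbrakk>left_ideal D J; h \<in> carrier P; f \<in> J\<rbrakk> \<Longrightarrow> h \<otimes>\<^bsub>D\<^esub> f \<in> J"
  by (simp add: left_ideal_def)

lemma left_ideal_smult:
  assumes "left_ideal D J" "a \<in> carrier R" "f \<in> J"
  shows "a \<odot>\<^bsub>P\<^esub> f \<in> J"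
proof -
  have "f \<in> carrier P" using left_ideal_subset assms by blast
  then show ?thesis
    using left_ideal_mult[OF assms(1) _ assms(3), of "monom P a 0"] assms(2)
    by (simp add: D_mult_const)
qed

lemma theta_mult: "f \<in> carrier P \<Longrightarrow> monom P \<one> 1 \<otimes>\<^bsub>D\<^esub> f = L f"
  using D_L_assoc[of "\<one>\<^bsub>P\<^esub>" f] Ln_one[of 1] by (simp add: D_l_one)

lemma left_ideal_L: "\<lbrakk>left_ideal D J; f \<in> J\<rbrakk> \<Longrightarrow> L f \<in> J"
  using theta_mult[of f] left_ideal_mult[of J "monom P \<one> 1" f] left_ideal_subset[of J]
  by (simp add: subset_iff)

lemma left_ideal_Ln: "left_ideal D J \<Longrightarrow> f \<in> J \<Longrightarrow> (L ^^ i) f \<in> J"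
  by (induction i) (auto simp: left_ideal_L)

text \<open>Division with remainder by \<open>g\<close>, after clearing denominators; remainders vanish because the degree
  of \<open>g\<close> is minimal.\<close>

lemma pow_lcoeff_smult_mem:
  assumes J: "left_ideal D J" and J': "left_ideal D J'" "J' \<subseteq> J"
    and g: "g \<in> J'" "\<And>k. k > d \<Longrightarrow> coeff P g k = \<zero>"
    and min: "\<And>f. \<lbrakk>f \<in> J; \<And>k. k \<ge> d \<Longrightarrow> coeff P f k = \<zero>\<rbrakk> \<Longrightarrow> f = \<zero>\<^bsub>P\<^esub>"
    and f: "f \<in> J" "\<And>k. k \<ge> d + m \<Longrightarrow> coeff P f k = \<zero>"
  shows "(coeff P g d [^] m) \<odot>\<^bsub>P\<^esub> f \<in> J'"
  using f
proof (induction m arbitrary: f)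
  case 0
  then have "f = \<zero>\<^bsub>P\<^esub>" using min by simp
  then show ?case using left_ideal_smult[OF J'(1)] additive_subgroup.zero_closed[OF left_ideal_additive[OF J'(1)]]
    by simp
next
  case (Suc m)
  have aJ: "additive_subgroup J P" "additive_subgroup J' P"
    using J J'(1) by (auto intro: left_ideal_additive)
  have P: "f \<in> carrier P" "g \<in> carrier P"
    using Suc.prems g J' additive_subgroup.a_subset[OF aJ(1)] by blast+
  have top: "(\<forall>k > i + d. coeff P ((L ^^ i) g) k = \<zero>) \<and> coeff P ((L ^^ i) g) (i + d) = coeff P g d" for i
    by (rule coeff_Ln_top[OF P(2)]) (rule g(2))
  let ?c = "coeff P g d" and ?e = "coeff P f (d + m)"
  let ?w = "?e \<odot>\<^bsub>P\<^esub> (L ^^ m) g"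
  \<comment> \<open>The element \<open>?w\<close> of \<open>J'\<close> has coefficient
    \<open>?e \<otimes> ?c\<close> in degree \<open>d + m\<close>, so \<open>?h\<close> loses the
    top term of \<open>?c\<close> times \<open>f\<close>.\<close>
  let ?h = "?c \<odot>\<^bsub>P\<^esub> f \<ominus>\<^bsub>P\<^esub> ?w"
  have ce: "?c \<in> carrier R" "?e \<in> carrier R" using P by simp_all
  have w: "?w \<in> J'" using left_ideal_smult left_ideal_Ln J' g ce by blast
  have "?h \<in> J"
    using additive_subgroup_P_minus[OF aJ(1)] left_ideal_smult[OF J ce(1) Suc.prems(1)] w J'(2) by blast
  moreover have "coeff P ?h k = \<zero>" if "k \<ge> d + m" for k
  proof (cases "k = d + m")
    case True
    have "coeff P ((L ^^ m) g) (m + d) = ?c" using top by blast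
    then show ?thesis using True P ce by (simp add: add.commute R.m_comm)
  next
    case False
    then show ?thesis using that Suc.prems(2)[of k] top[of m] P ce by (simp add: add.commute)
  qed
  ultimately have "(?c [^] m) \<odot>\<^bsub>P\<^esub> ?h \<in> J'" by (rule Suc.IH)
  moreover have "(?c [^] m) \<odot>\<^bsub>P\<^esub> ?w \<in> J'" using left_ideal_smult[OF J'(1)] w ce by simp
  ultimately have "(?c [^] m) \<odot>\<^bsub>P\<^esub> ?h \<oplus>\<^bsub>P\<^esub> (?c [^] m) \<odot>\<^bsub>P\<^esub> ?w \<in> J'"
    using additive_subgroup.a_closed[OF aJ(2)] by blast
  moreover have "(?c [^] m) \<odot>\<^bsub>P\<^esub> ?h \<oplus>\<^bsub>P\<^esub> (?c [^] m) \<odot>\<^bsub>P\<^esub> ?w = (?c [^] m) \<odot>\<^bsub>P\<^esub> (?h \<oplus>\<^bsub>P\<^esub> ?w)"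
    using P ce by (simp add: U.UP_smult_r_distr)
  moreover have "?h \<oplus>\<^bsub>P\<^esub> ?w = ?c \<odot>\<^bsub>P\<^esub> f"
    using P ce by (simp add: a_minus_def U.P.a_assoc U.P.l_neg)
  ultimately show ?case using P ce by (simp add: U.UP_smult_assoc1)
qed

text \<open>The elements of \<open>R\<close> that multiply \<open>J\<close> into \<open>J'\<close>
  form a \<delta>-ideal containing a power of the leading coefficient of \<open>g\<close>. This
  power is nonzero in a domain, so by \<delta>-simplicity the \<delta>-ideal contains
  \<open>\<one>\<close>.\<close>

lemma left_ideal_eqI:
  assumes dom: "noetherian_domain R" and simple: "delta_simple R \<delta>"
    and J: "left_ideal D J" and J': "left_ideal D J'" "J' \<subseteq> J"
    and g: "g \<in> J'" "\<And>k. k > d \<Longrightarrow> coeff P g k = \<zero>" "coeff P g d \<noteq> \<zero>"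
    and min: "\<And>f. \<lbrakk>f \<in> J; \<And>k. k \<ge> d \<Longrightarrow> coeff P f k = \<zero>\<rbrakk> \<Longrightarrow> f = \<zero>\<^bsub>P\<^esub>"
    and lcoeffs: "(\<Union>n. lcoeffs J n) \<subseteq> (\<Union>n. lcoeffs J' n)"
  shows "J = J'"
proof -
  interpret N: noetherian_domain R by fact
  have aJ: "additive_subgroup J P" "additive_subgroup J' P"
    using J J'(1) by (auto intro: left_ideal_additive)
  have sub: "f \<in> carrier P" if "f \<in> J" for f using additive_subgroup.a_subset[OF aJ(1)] that by blast
  note st = left_ideal_lcoeffs_stable[OF J'(1)]
  have "\<exists>k. \<forall>i\<ge>k. lcoeffs J' i = lcoeffs J' k"
    by (rule N.ascending_ideals_stabilize) (simp_all add: lcoeffs_ideal lcoeffs_Suc_mono st)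
  then obtain N where N: "\<And>i. i \<ge> N \<Longrightarrow> lcoeffs J' i = lcoeffs J' N" by blast
  \<comment> \<open>From degree \<open>N\<close> on, \<open>lcoeffs J'\<close> equals its union over
    all degrees, so the inclusion of unions holds degree by degree.\<close>
  have lcN: "lcoeffs J n \<subseteq> lcoeffs J' n" if "n \<ge> N" for n
  proof
    fix c assume "c \<in> lcoeffs J n"
    then obtain m where "c \<in> lcoeffs J' m" using lcoeffs by blast
    then have "c \<in> lcoeffs J' (max m N)" using lcoeffs_Suc_mono[OF st, of m "max m N"] by auto
    then show "c \<in> lcoeffs J' n" using N[of "max m N"] N[OF that] by simp
  qed
  let ?c = "coeff P g d [^] N"
  have g0: "coeff P g d \<in> carrier R" using g(1) sub J'(2) by auto
  then have c: "?c \<in> carrier R" "?c \<noteq> \<zero>"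
    using g(3) by (induction N) (auto simp: N.integral_iff)
  have cJ: "?c \<odot>\<^bsub>P\<^esub> f \<in> J'" if f: "f \<in> J" for f
  proof -
    obtain h where h: "h \<in> J'" "f \<ominus>\<^bsub>P\<^esub> h \<in> J" "\<forall>k\<ge>N. coeff P (f \<ominus>\<^bsub>P\<^esub> h) k = \<zero>"
      using reduce_modulo[OF aJ J'(2) lcN f] by blast
    \<comment> \<open>The remainder vanishes from degree \<open>N\<close> on, hence from
      \<open>d + N\<close> on, so the exponent \<open>N\<close> suffices for every
      \<open>f\<close>.\<close>
    have "?c \<odot>\<^bsub>P\<^esub> (f \<ominus>\<^bsub>P\<^esub> h) \<in> J'"
      by (rule pow_lcoeff_smult_mem[OF J J' g(1,2) min h(2)]) (use h in auto)
    moreover have "?c \<odot>\<^bsub>P\<^esub> h \<in> J'" using left_ideal_smult[OF J'(1)] c h by blast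
    ultimately have "?c \<odot>\<^bsub>P\<^esub> (f \<ominus>\<^bsub>P\<^esub> h) \<oplus>\<^bsub>P\<^esub> ?c \<odot>\<^bsub>P\<^esub> h \<in> J'"
      using additive_subgroup.a_closed[OF aJ(2)] by blast
    moreover have fh: "f \<in> carrier P" "h \<in> carrier P" using f h J'(2) sub by blast+
    have "?c \<odot>\<^bsub>P\<^esub> (f \<ominus>\<^bsub>P\<^esub> h) \<oplus>\<^bsub>P\<^esub> ?c \<odot>\<^bsub>P\<^esub> h = ?c \<odot>\<^bsub>P\<^esub> (f \<ominus>\<^bsub>P\<^esub> h \<oplus>\<^bsub>P\<^esub> h)"
      using fh c by (simp add: U.UP_smult_r_distr)
    moreover have "f \<ominus>\<^bsub>P\<^esub> h \<oplus>\<^bsub>P\<^esub> h = f"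
      using fh by (simp add: a_minus_def U.P.a_assoc U.P.l_neg)
    ultimately show ?thesis by simp
  qed
  define A where "A = {r \<in> carrier R. \<forall>f \<in> J. r \<odot>\<^bsub>P\<^esub> f \<in> J'}"
  have "ideal A R"
  proof (rule R.cring_idealI)
    show "A \<subseteq> carrier R" "A \<noteq> {}" using c cJ by (auto simp: A_def)
    show "a \<ominus> b \<in> A" if ab: "a \<in> A" "b \<in> A" for a b
    proof -
      have "(a \<ominus> b) \<odot>\<^bsub>P\<^esub> f = a \<odot>\<^bsub>P\<^esub> f \<ominus>\<^bsub>P\<^esub> b \<odot>\<^bsub>P\<^esub> f" if "f \<in> J" for f
        using sub[OF that] ab by (intro U.up_eqI) (auto simp: A_def a_minus_def R.l_distr R.l_minus)
      then show ?thesis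
        using ab additive_subgroup_P_minus[OF aJ(2)] by (simp add: A_def)
    qed
    show "x \<otimes> a \<in> A" if "a \<in> A" "x \<in> carrier R" for a x
      using that left_ideal_smult[OF J'(1)] sub by (auto simp: A_def U.UP_smult_assoc1)
  qed
  moreover have "\<delta> a \<in> A" if a: "a \<in> A" for a
  proof -
    have "\<delta> a \<odot>\<^bsub>P\<^esub> f \<in> J'" if f: "f \<in> J" for f
    proof -
      have aR: "a \<in> carrier R" using a by (simp add: A_def)
      \<comment> \<open>Both terms lie in \<open>J'\<close>: the first because \<open>a\<close>
        sends \<open>f\<close> into \<open>J'\<close>, the second because \<open>L f\<close> is
        again in \<open>J\<close>. Their difference is \<delta>(a)f by the commutation rule.\<close>
      have "L (a \<odot>\<^bsub>P\<^esub> f) \<ominus>\<^bsub>P\<^esub> a \<odot>\<^bsub>P\<^esub> L f \<in> J'"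
        using a f left_ideal_L[OF J'(1)] left_ideal_L[OF J] additive_subgroup_P_minus[OF aJ(2)]
        by (simp add: A_def)
      moreover have "L (a \<odot>\<^bsub>P\<^esub> f) \<ominus>\<^bsub>P\<^esub> a \<odot>\<^bsub>P\<^esub> L f = \<delta> a \<odot>\<^bsub>P\<^esub> f"
        using aR sub[OF f]
        by (simp add: L_smult a_minus_def U.P.a_ac U.P.r_neg U.P.r_neg1 U.P.r_neg2)
      ultimately show ?thesis by simp
    qed
    then show ?thesis using a by (simp add: A_def)
  qed
  ultimately have "A = {\<zero>} \<or> A = carrier R"
    using simple unfolding delta_simple_def delta_ideal_def by blast
  moreover have "?c \<in> A" using c cJ by (simp add: A_def)
  ultimately have "\<one> \<in> A" using c by auto
  then have "J \<subseteq> J'" using sub by (force simp: A_def)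
  then show ?thesis using J'(2) by blast
qed

text \<open>The nonzero left ideal \<open>I\<close> bounds both invariants of \<open>J i\<close>: an
  element of \<open>I\<close> bounds the minimal degree from above, and its leading coefficient
  keeps the leading coefficient ideals above a fixed nonzero ideal. Once both are constant,
  \<open>left_ideal_eqI\<close> applies.\<close>

lemma descending_left_ideals_stabilize:
  fixes J :: "nat \<Rightarrow> (nat \<Rightarrow> 'a) set"
  assumes dom: "noetherian_domain R" and simple: "delta_simple R \<delta>" and dim: "krull_dim R \<le> 1"
    and I: "left_ideal D I" "I \<noteq> {\<zero>\<^bsub>P\<^esub>}"
    and J: "\<And>i. left_ideal D (J i)" "\<And>i. I \<subseteq> J i" "\<And>i. J (Suc i) \<subseteq> J i"
  shows "\<exists>k. \<forall>i\<ge>k. J i = J k"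
proof -
  interpret N: noetherian_domain R by fact
  have anti: "J j \<subseteq> J i" if "i \<le> j" for i j
    using lift_Suc_antimono_le[of J i j] J(3) that by blast
  note st = left_ideal_lcoeffs_stable[OF J(1)]
  \<comment> \<open>\<open>top K n\<close> means that \<open>n\<close> is the degree of some nonzero
    element of \<open>K\<close>.\<close>
  define top where "top K n \<longleftrightarrow> (\<exists>f \<in> K. coeff P f n \<noteq> \<zero> \<and> (\<forall>k>n. coeff P f k = \<zero>))" for K n
  have top_mono: "top K n \<Longrightarrow> K \<subseteq> K' \<Longrightarrow> top K' n" for K K' n
    unfolding top_def by blast
  have top_deg: "top K (deg R f)" if "f \<in> K" "f \<in> carrier P" "f \<noteq> \<zero>\<^bsub>P\<^esub>" for K f
    unfolding top_def using that U.lcoeff_nonzero[of f] U.deg_aboveD[of f] by blast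
  obtain f0 where f0: "f0 \<in> I" "f0 \<noteq> \<zero>\<^bsub>P\<^esub>"
    using I additive_subgroup.zero_closed[OF left_ideal_additive[OF I(1)]] by blast
  define n0 where "n0 = deg R f0"
  have n0: "top I n0"
    unfolding n0_def using f0 left_ideal_subset[OF I(1)] by (intro top_deg) auto
  define d where "d i = (LEAST n. top (J i) n)" for i
  have top_d: "top (J i) (d i)" for i
    unfolding d_def using top_mono[OF n0 J(2)] by (rule LeastI)
  have d_mono: "d i \<le> d j" if "i \<le> j" for i j
    unfolding d_def[of i] by (intro Least_le top_mono[OF top_d anti] that)
  have d_bound: "d i \<le> n0" for i
    unfolding d_def by (intro Least_le top_mono[OF n0 J(2)])
  \<comment> \<open>The minimal degrees grow as the left ideals shrink and never exceed
    \<open>n0\<close>, so a largest value is attained and then kept.\<close>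
  obtain i0 where i0: "\<And>i. d i \<le> d i0"
    using ex_has_greatest_nat[of "\<lambda>_. True" 0 d "Suc n0"] d_bound
    by (auto simp: less_Suc_eq_le)
  have d_const: "d i = d i0" if "i \<ge> i0" for i
    using i0[of i] d_mono[OF that] by simp
  \<comment> \<open>The union over all degrees is attained at a finite stage, since \<open>R\<close>
    is Noetherian; hence it is an ideal.\<close>
  define A where "A i = (\<Union>n. lcoeffs (J i) n)" for i
  have A_ideal: "ideal (A i) R" for i
  proof -
    have "\<exists>k. \<forall>n\<ge>k. lcoeffs (J i) n = lcoeffs (J i) k"
      by (rule N.ascending_ideals_stabilize) (simp_all add: lcoeffs_ideal lcoeffs_Suc_mono st)
    then obtain k where k: "\<And>n. n \<ge> k \<Longrightarrow> lcoeffs (J i) n = lcoeffs (J i) k" by blast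
    have "lcoeffs (J i) n \<subseteq> lcoeffs (J i) k" for n
      using lcoeffs_Suc_mono[OF st[of i], of n "max n k"] k[of "max n k"] by simp
    then have "A i = lcoeffs (J i) k" unfolding A_def by blast
    then show ?thesis by (simp add: lcoeffs_ideal st)
  qed
  have "\<exists>k. \<forall>i\<ge>k. A i = A k"
  proof (rule N.descending_ideals_stabilize[OF dim])
    show "ideal (lcoeffs I n0) R" by (rule lcoeffs_ideal[OF left_ideal_lcoeffs_stable[OF I(1)]])
    show "lcoeffs I n0 \<noteq> {\<zero>}" using n0 lcoeffsI[of _ I n0] unfolding top_def by (metis singletonD)
    show "ideal (A i) R" for i by (rule A_ideal)
    show "lcoeffs I n0 \<subseteq> A i" for i unfolding A_def using lcoeffs_mono[OF J(2)] by blast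
    show "A (Suc i) \<subseteq> A i" for i unfolding A_def using lcoeffs_mono[OF J(3)] by blast
  qed
  then obtain k where k: "\<And>i. i \<ge> k \<Longrightarrow> A i = A k" by blast
  define K where "K = max k i0"
  have "J K = J i" if i: "i \<ge> K" for i
  proof -
    obtain g where g: "g \<in> J i" "coeff P g (d i) \<noteq> \<zero>" "\<forall>k>d i. coeff P g k = \<zero>"
      using top_d unfolding top_def by blast
    have di: "d i = d K" using d_const[of i] d_const[of K] i by (simp add: K_def)
    show ?thesis
    proof (rule left_ideal_eqI[OF dom simple J(1) J(1) anti[OF i] g(1) _ g(2)])
      show "coeff P g k = \<zero>" if "k > d i" for k using g(3) that by blast
      show "f = \<zero>\<^bsub>P\<^esub>" if f: "f \<in> J K" "\<And>k. k \<ge> d i \<Longrightarrow> coeff P f k = \<zero>" for f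
      proof (rule ccontr)
        assume ne: "f \<noteq> \<zero>\<^bsub>P\<^esub>"
        have fP: "f \<in> carrier P" using f left_ideal_subset[OF J(1)] by blast
        have "d K \<le> deg R f"
          unfolding d_def by (intro Least_le top_deg[OF f(1) fP ne])
        then show False using f(2)[of "deg R f"] U.lcoeff_nonzero[OF ne fP] di by simp
      qed
      show "(\<Union>n. lcoeffs (J K) n) \<subseteq> (\<Union>n. lcoeffs (J i) n)"
        using k[of i] k[of K] i unfolding A_def K_def by simp
    qed
  qed
  then show ?thesis by blast
qed

section \<open>Multiplication by \<theta> raises the degree\<close>

lemma theta_closed: "monom P \<one> 1 \<in> carrier P"
  by simp

lemma L_eq_zero:
  assumes f: "f \<in> carrier P" and eq: "L f = \<zero>\<^bsub>P\<^esub>"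
  shows "f = \<zero>\<^bsub>P\<^esub>"
proof (rule ccontr)
  assume "f \<noteq> \<zero>\<^bsub>P\<^esub>"
  moreover have "coeff P (L f) (Suc (deg R f)) = coeff P f (deg R f)"
    using f by (simp add: coeff_L U.deg_aboveD)
  ultimately show False using U.lcoeff_nonzero[of f] f eq by simp
qed

text \<open>Over a domain degrees add, so for nonzero \<open>f\<close> and \<open>h\<close> the
  product of \<open>h\<close> and \<open>L f\<close> has degree
  \<open>deg R h + deg R f + 1\<close>, more than that of \<open>f\<close>.\<close>

lemma theta_multiple_degree:
  assumes dom: "domain R" and f: "f \<in> carrier P" and h: "h \<in> carrier P"
    and eq: "f = h \<otimes>\<^bsub>D\<^esub> L f"
  shows "f = \<zero>\<^bsub>P\<^esub>"
proof (rule ccontr)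
  interpret dom: domain R by fact
  assume f0: "f \<noteq> \<zero>\<^bsub>P\<^esub>"
  then have h0: "h \<noteq> \<zero>\<^bsub>P\<^esub>" using eq D_zero_mult f by auto
  let ?m = "deg R h" and ?n = "deg R f"
  have Lf: "coeff P (L f) k = \<zero>" if "k > Suc ?n" for k
    using that f by (auto simp: coeff_L U.deg_aboveD split: nat.split)
  have "coeff P (h \<otimes>\<^bsub>D\<^esub> L f) (?m + Suc ?n) = coeff P h ?m \<otimes> coeff P (L f) (Suc ?n)"
    by (rule D_mult_top(2)) (use f h Lf in \<open>auto simp: U.deg_aboveD\<close>)
  moreover have "coeff P (L f) (Suc ?n) = coeff P f ?n"
    using f by (simp add: coeff_L U.deg_aboveD)
  moreover have "coeff P f (?m + Suc ?n) = \<zero>"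
    using f by (simp add: U.deg_aboveD)
  ultimately have "coeff P h ?m \<otimes> coeff P f ?n = \<zero>" using eq by metis
  then show False
    using f h f0 h0 U.lcoeff_nonzero by (simp add: dom.integral_iff)
qed

end

section \<open>Submodules and left ideals\<close>

context left_module
begin

lemma smult_l_zero:
  assumes "x \<in> carrier M" shows "\<zero> \<odot>\<^bsub>M\<^esub> x = \<zero>\<^bsub>M\<^esub>"
proof -
  have "\<zero> \<odot>\<^bsub>M\<^esub> x \<oplus>\<^bsub>M\<^esub> \<zero> \<odot>\<^bsub>M\<^esub> x = \<zero> \<odot>\<^bsub>M\<^esub> x"
    using smult_l_distr[of \<zero> \<zero> x] assms by simp
  then show ?thesis using smult_closed[of \<zero> x] assms by simp
qed

lemma smult_l_minus:
  assumes "a \<in> carrier S" "x \<in> carrier M" shows "(\<ominus> a) \<odot>\<^bsub>M\<^esub> x = \<ominus>\<^bsub>M\<^esub> (a \<odot>\<^bsub>M\<^esub> x)"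
proof (rule M.minus_equality[symmetric])
  show "(\<ominus> a) \<odot>\<^bsub>M\<^esub> x \<oplus>\<^bsub>M\<^esub> a \<odot>\<^bsub>M\<^esub> x = \<zero>\<^bsub>M\<^esub>"
    using smult_l_distr[of "\<ominus> a" a x] assms by (simp add: S.l_neg smult_l_zero)
qed (use assms smult_closed in auto)

lemma smult_l_diff:
  "\<lbrakk>a \<in> carrier S; b \<in> carrier S; x \<in> carrier M\<rbrakk> \<Longrightarrow>
    (a \<ominus> b) \<odot>\<^bsub>M\<^esub> x = a \<odot>\<^bsub>M\<^esub> x \<ominus>\<^bsub>M\<^esub> b \<odot>\<^bsub>M\<^esub> x"
  by (simp add: a_minus_def smult_l_distr smult_l_minus)

lemma smult_r_zero:
  assumes "a \<in> carrier S" shows "a \<odot>\<^bsub>M\<^esub> \<zero>\<^bsub>M\<^esub> = \<zero>\<^bsub>M\<^esub>"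
proof -
  have "a \<odot>\<^bsub>M\<^esub> \<zero>\<^bsub>M\<^esub> \<oplus>\<^bsub>M\<^esub> a \<odot>\<^bsub>M\<^esub> \<zero>\<^bsub>M\<^esub> = a \<odot>\<^bsub>M\<^esub> \<zero>\<^bsub>M\<^esub>"
    using smult_r_distr[of a "\<zero>\<^bsub>M\<^esub>" "\<zero>\<^bsub>M\<^esub>"] assms by simp
  then show ?thesis using smult_closed[of a "\<zero>\<^bsub>M\<^esub>"] assms by simp
qed

lemma submoduleI:
  assumes "N \<subseteq> carrier M" "N \<noteq> {}" "\<And>y. y \<in> N \<Longrightarrow> \<ominus>\<^bsub>M\<^esub> y \<in> N"
    "\<And>y z. \<lbrakk>y \<in> N; z \<in> N\<rbrakk> \<Longrightarrow> y \<oplus>\<^bsub>M\<^esub> z \<in> N"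
    "\<And>a y. \<lbrakk>a \<in> carrier S; y \<in> N\<rbrakk> \<Longrightarrow> a \<odot>\<^bsub>M\<^esub> y \<in> N"
  shows "submodule N S M"
  by (intro submodule.intro submodule_axioms.intro M.add.subgroupI)
    (use assms in \<open>simp_all add: a_inv_def\<close>)

lemma zero_submodule: "submodule {\<zero>\<^bsub>M\<^esub>} S M"
  by (rule submoduleI) (auto simp: smult_r_zero)

lemma submodule_subset: "submodule N S M \<Longrightarrow> N \<subseteq> carrier M"
  using subgroup.subset[OF submodule.axioms(1)] by fastforce

lemma submodule_zero: "submodule N S M \<Longrightarrow> \<zero>\<^bsub>M\<^esub> \<in> N"
  using subgroup.one_closed[OF submodule.axioms(1)] by fastforce

lemma submodule_minus:
  assumes N: "submodule N S M" "x \<in> N" "y \<in> N" shows "x \<ominus>\<^bsub>M\<^esub> y \<in> N"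
proof -
  have "\<ominus>\<^bsub>M\<^esub> y \<in> N"
    using subgroup.m_inv_closed[OF submodule.axioms(1)[OF N(1)] N(3)] by (simp add: a_inv_def)
  then show ?thesis
    using subgroup.m_closed[OF submodule.axioms(1)[OF N(1)] N(2)] by (simp add: a_minus_def)
qed

text \<open>For a generator \<open>x\<close> this carries chains of submodules over to chains of
  left ideals containing the annihilator of \<open>x\<close>.\<close>

lemma submodule_preimage_left_ideal:
  assumes N: "submodule N S M" and x: "x \<in> carrier M"
  shows "left_ideal S {a \<in> carrier S. a \<odot>\<^bsub>M\<^esub> x \<in> N}"
  unfolding left_ideal_def
proof (intro conjI ballI)
  have "\<zero> \<in> {a \<in> carrier S. a \<odot>\<^bsub>M\<^esub> x \<in> N}"
    using x submodule_zero[OF N] by (simp add: smult_l_zero)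
  then show "additive_subgroup {a \<in> carrier S. a \<odot>\<^bsub>M\<^esub> x \<in> N} S"
    using x submodule_minus[OF N] by (intro S.additive_subgroup_minusI) (auto simp: smult_l_diff)
  fix a b assume "a \<in> carrier S" "b \<in> {a \<in> carrier S. a \<odot>\<^bsub>M\<^esub> x \<in> N}"
  then show "a \<otimes> b \<in> {a \<in> carrier S. a \<odot>\<^bsub>M\<^esub> x \<in> N}"
    using x submodule.smult_closed[OF N] by (simp add: smult_assoc)
qed

lemma cyclic_submodule:
  assumes x: "x \<in> carrier M" shows "submodule ((\<lambda>a. a \<odot>\<^bsub>M\<^esub> x) ` carrier S) S M"
proof (rule submoduleI)
  let ?N = "(\<lambda>a. a \<odot>\<^bsub>M\<^esub> x) ` carrier S"
  show "?N \<subseteq> carrier M" using x smult_closed by auto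
  show "?N \<noteq> {}" by blast
  show "\<ominus>\<^bsub>M\<^esub> y \<in> ?N" if y: "y \<in> ?N" for y
  proof -
    obtain a where "a \<in> carrier S" "y = a \<odot>\<^bsub>M\<^esub> x" using y by blast
    then show ?thesis using x by (intro image_eqI[of _ _ "\<ominus> a"]) (auto simp: smult_l_minus)
  qed
  show "y \<oplus>\<^bsub>M\<^esub> z \<in> ?N" if yz: "y \<in> ?N" "z \<in> ?N" for y z
  proof -
    obtain a b where "a \<in> carrier S" "y = a \<odot>\<^bsub>M\<^esub> x" "b \<in> carrier S" "z = b \<odot>\<^bsub>M\<^esub> x"
      using yz by blast
    then show ?thesis using x by (intro image_eqI[of _ _ "a \<oplus> b"]) (auto simp: smult_l_distr)
  qed
  show "b \<odot>\<^bsub>M\<^esub> y \<in> ?N" if b: "b \<in> carrier S" and y: "y \<in> ?N" for b y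
  proof -
    obtain a where "a \<in> carrier S" "y = a \<odot>\<^bsub>M\<^esub> x" using y by blast
    then show ?thesis using x b by (intro image_eqI[of _ _ "b \<otimes> a"]) (auto simp: smult_assoc)
  qed
qed

text \<open>Simplicity of \<open>E\<close> concerns the module with carrier \<open>E\<close>,
  whereas submodules are constructed inside \<open>M\<close>.\<close>

lemma submodule_restrict:
  assumes "submodule N S M" "submodule E S M" "N \<subseteq> E"
  shows "submodule N S (M\<lparr>carrier := E\<rparr>)"
proof -
  have "subgroup N ((add_monoid M)\<lparr>carrier := E\<rparr>)"
    by (rule M.add.subgroup_incl[OF submodule.axioms(1)[OF assms(1)] submodule.axioms(1)[OF assms(2)] assms(3)])
  then show ?thesis
    using submodule.smult_closed[OF assms(1)]
    by (intro submodule.intro submodule_axioms.intro) simp_all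
qed

end

section \<open>Cyclic essential extensions of simple modules\<close>

theorem proposition2p5:
  fixes R :: "('a, 'b) ring_scheme" and \<delta> :: "'a \<Rightarrow> 'a"
  assumes "noetherian_domain R"
    and "torsion_free R"
    and "derivation R \<delta>"
    and "delta_simple R \<delta>"
    and "krull_dim R \<le> 1"
  shows "diamond (diff_op_ring R \<delta>) TYPE('m)"
  unfolding diamond_def
proof (intro conjI allI impI)
  interpret derivation R \<delta> by fact
  interpret dom: noetherian_domain R by fact
  let ?S = "diff_op_ring R \<delta>"
  show "nc_noetherian ?S"
    by (rule nc_noetherian_D[OF dom.noetherian_ring_axioms])
  fix M :: "(nat \<Rightarrow> 'a, 'm) module" and E
  assume *: "simple_module ?S (M\<lparr>carrier := E\<rparr>) \<and> essential_extension ?S E M \<and> cyclic_module ?S M"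
  then obtain x where M: "left_module ?S M" and x: "x \<in> carrier M"
    and gen: "carrier M = (\<lambda>a. a \<odot>\<^bsub>M\<^esub> x) ` carrier ?S"
    unfolding cyclic_module_def by blast
  interpret M: left_module ?S M by (rule M)
  have E: "submodule E ?S M" using * by (simp add: essential_extension_def)
  have E0: "E \<noteq> {\<zero>\<^bsub>M\<^esub>}" and Esimple: "\<And>N. submodule N ?S (M\<lparr>carrier := E\<rparr>) \<Longrightarrow> N = {\<zero>\<^bsub>M\<^esub>} \<or> N = E"
    using * by (auto simp: simple_module_def)
  define pre where "pre N = {a \<in> carrier ?S. a \<odot>\<^bsub>M\<^esub> x \<in> N}" for N
  have pre: "left_ideal ?S (pre N)" if "submodule N ?S M" for N
    unfolding pre_def by (rule M.submodule_preimage_left_ideal[OF that x])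
  \<comment> \<open>This is the annihilator of the generator \<open>x\<close>.\<close>
  let ?I = "pre {\<zero>\<^bsub>M\<^esub>}"
  have "?I \<noteq> {\<zero>\<^bsub>?S\<^esub>}"
  proof
    assume I0: "?I = {\<zero>\<^bsub>?S\<^esub>}"
    obtain e where e: "e \<in> E" "e \<noteq> \<zero>\<^bsub>M\<^esub>" using E0 M.submodule_zero[OF E] by blast
    then have "e \<in> carrier M" using M.submodule_subset[OF E] by blast
    then obtain f where f: "f \<in> carrier ?S" "e = f \<odot>\<^bsub>M\<^esub> x" unfolding gen by blast
    have fP: "f \<in> carrier (UP R)" using f by simp
    define t where "t = monom (UP R) \<one>\<^bsub>R\<^esub> 1"
    have t: "t \<in> carrier ?S" using theta_closed by (simp add: t_def)
    have tf: "t \<otimes>\<^bsub>?S\<^esub> f \<in> carrier ?S" by (rule M.S.m_closed[OF t f(1)])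
    \<comment> \<open>With zero annihilator, \<open>M\<close> is a copy of the ring itself. The
      submodule generated by \<open>y\<close> corresponds to \<open>S\<theta>f\<close>; by
      simplicity it is zero or all of \<open>E\<close>, and either case makes \<open>f\<close> a
      left multiple of \<theta>f.\<close>
    define y where "y = (t \<otimes>\<^bsub>?S\<^esub> f) \<odot>\<^bsub>M\<^esub> x"
    have y: "y \<in> E"
      using submodule.smult_closed[OF E t e(1)] f t x by (simp add: y_def M.smult_assoc)
    have yM: "y \<in> carrier M" using y M.submodule_subset[OF E] by blast
    let ?N = "(\<lambda>a. a \<odot>\<^bsub>M\<^esub> y) ` carrier ?S"
    have N: "submodule ?N ?S M" by (rule M.cyclic_submodule[OF yM])
    have NE: "?N \<subseteq> E" by (rule image_subsetI) (rule submodule.smult_closed[OF E _ y])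
    have "submodule ?N ?S (M\<lparr>carrier := E\<rparr>)" by (rule M.submodule_restrict[OF N E NE])
    then have disj: "?N = {\<zero>\<^bsub>M\<^esub>} \<or> ?N = E" by (rule Esimple)
    have "\<exists>h \<in> carrier ?S. f = h \<otimes>\<^bsub>?S\<^esub> (t \<otimes>\<^bsub>?S\<^esub> f)"
      using disj
    proof (rule disjE)
      assume "?N = {\<zero>\<^bsub>M\<^esub>}"
      moreover have "y \<in> ?N"
        by (rule image_eqI[where x = "\<one>\<^bsub>?S\<^esub>"]) (rule M.smult_one[OF yM, symmetric], rule M.S.one_closed)
      ultimately have "y = \<zero>\<^bsub>M\<^esub>" by auto
      then have "t \<otimes>\<^bsub>?S\<^esub> f \<in> ?I" using tf by (simp add: pre_def y_def)
      then have "t \<otimes>\<^bsub>?S\<^esub> f = \<zero>\<^bsub>?S\<^esub>" using I0 by blast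
      then have "f = \<zero>\<^bsub>?S\<^esub>" using L_eq_zero[OF fP] theta_mult[OF fP] by (simp add: t_def)
      then show ?thesis using e f M.smult_l_zero[OF x] by simp
    next
      assume "?N = E"
      then have "e \<in> ?N" using e(1) by (simp only:)
      then obtain h where h: "h \<in> carrier ?S" "e = h \<odot>\<^bsub>M\<^esub> y" by (rule imageE)
      have htf: "h \<otimes>\<^bsub>?S\<^esub> (t \<otimes>\<^bsub>?S\<^esub> f) \<in> carrier ?S" by (rule M.S.m_closed[OF h(1) tf])
      \<comment> \<open>The difference annihilates \<open>x\<close>, so it vanishes by
        \<open>I0\<close>.\<close>
      have "(f \<ominus>\<^bsub>?S\<^esub> h \<otimes>\<^bsub>?S\<^esub> (t \<otimes>\<^bsub>?S\<^esub> f)) \<odot>\<^bsub>M\<^esub> x = e \<ominus>\<^bsub>M\<^esub> e"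
        using M.smult_l_diff[OF f(1) htf x] M.smult_assoc[OF h(1) tf x] h f by (simp add: y_def)
      then have "f \<ominus>\<^bsub>?S\<^esub> h \<otimes>\<^bsub>?S\<^esub> (t \<otimes>\<^bsub>?S\<^esub> f) \<in> ?I"
        using M.S.minus_closed[OF f(1) htf] e M.submodule_subset[OF E]
        by (simp add: pre_def M.M.r_neg a_minus_def[of M] subset_iff)
      then have "f = h \<otimes>\<^bsub>?S\<^esub> (t \<otimes>\<^bsub>?S\<^esub> f)"
        using I0 M.S.r_right_minus_eq[OF f(1) htf] by blast
      then show ?thesis using h by blast
    qed
    then have "f = \<zero>\<^bsub>?S\<^esub>"
      using theta_multiple_degree[OF dom.domain_axioms fP] theta_mult[OF fP] by (auto simp: t_def)
    then show False using e f M.smult_l_zero[OF x] by simp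
  qed
  then have stab: "\<exists>k. \<forall>i\<ge>k. J i = J k"
    if "\<And>i. left_ideal ?S (J i)" "\<And>i. ?I \<subseteq> J i" "\<And>i. J (Suc i) \<subseteq> J i" for J
    using descending_left_ideals_stabilize[OF assms(1,4,5) pre[OF M.zero_submodule], of J] that by simp
  show "artinian_module ?S M"
    unfolding artinian_module_def
  proof (intro conjI allI impI)
    show "left_module ?S M" by (rule M)
    fix N :: "nat \<Rightarrow> 'm set"
    assume N: "(\<forall>i. submodule (N i) ?S M) \<and> (\<forall>i. N (Suc i) \<subseteq> N i)"
    have "\<exists>k. \<forall>i\<ge>k. pre (N i) = pre (N k)"
    proof (rule stab)
      show "left_ideal ?S (pre (N i))" for i using N pre by blast
      show "?I \<subseteq> pre (N i)" for i using N M.submodule_zero[of "N i"] by (auto simp: pre_def)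
      show "pre (N (Suc i)) \<subseteq> pre (N i)" for i using N by (auto simp: pre_def)
    qed
    \<comment> \<open>Since \<open>x\<close> generates \<open>M\<close>, a submodule is recovered
      from its preimage, so stability passes back from the left ideals.\<close>
    moreover have "N i = (\<lambda>a. a \<odot>\<^bsub>M\<^esub> x) ` pre (N i)" for i
      using M.submodule_subset[of "N i"] N gen by (auto simp: pre_def)
    ultimately show "\<exists>k. \<forall>i\<ge>k. N i = N k" by metis
  qed
qed

end
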